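(* Let $\mathrm{P}$ be a convex Euclidean polygon with vertex set $X$. Let $(T_i)_{0\leq i\leq k}$ be a geodesic path in the flip-graph $\mathcal{F}(\mathrm{P},X)$ and let $\tau$ be a triangle with vertices in $X$. If each of the three edges of $\tau$ belongs to some (possibly different) triangulation among $T_0,\ldots,T_k$, then there exists $i\in\{0,\ldots,k\}$ such that $\tau$ is a triangle of $T_i$ (that is, the three edges of $\tau$ all belong to $T_i$).
   Context: An arc is a line segment between two distinct points of $X$. Two distinct arcs cross when their relative interiors intersect. A triangulation of $\mathrm{P}$ with vertex set $X$ is an inclusion-maximal set of pairwise non-crossing arcs (so it contains the edges of $\mathrm{P}$). The flip-graph $\mathcal{F}(\mathrm{P},X)$ is the graph whose vertices are the triangulations of $\mathrm{P}$ with vertex set $X$ and whose edges connect two triangulations that differ by exactly one arc (such triangulations are related by a flip). A geodesic path is a path in $\mathcal{F}(\mathrm{P},X)$ whose number of edges is the graph distance between its endpoints; it is identified with the sequence of triangulations along it. *)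

theory Defs
  imports "HOL-Analysis.Analysis" "Graph_Theory.Graph_Theory"
begin

definition convex_polygon :: "(real^2) set \<Rightarrow> (real^2) set \<Rightarrow> bool" where
  "convex_polygon P X \<longleftrightarrow> polytope P \<and> aff_dim P = 2 \<and> X = {x. x extreme_point_of P}"

definition segs :: "(real^2) set \<Rightarrow> (real^2) set set" where
  "segs X = {closed_segment x y | x y. x \<in> X \<and> y \<in> X \<and> x \<noteq> y}"

definition crossing :: "(real^2) set \<Rightarrow> (real^2) set \<Rightarrow> bool" where
  "crossing s t \<longleftrightarrow> s \<noteq> t \<and> rel_interior s \<inter> rel_interior t \<noteq> {}"

definition noncrossing :: "(real^2) set \<Rightarrow> (real^2) set set \<Rightarrow> bool" where
  "noncrossing X T \<longleftrightarrow> T \<subseteq> segs X \<and> (\<forall>s\<in>T. \<forall>t\<in>T. \<not> crossing s t)"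

definition triangulation :: "(real^2) set \<Rightarrow> (real^2) set set \<Rightarrow> bool" where
  "triangulation X T \<longleftrightarrow> noncrossing X T \<and> (\<forall>U. noncrossing X U \<and> T \<subseteq> U \<longrightarrow> U = T)"

text \<open>Two triangulations differ by exactly one arc when each has exactly one arc that the
  other lacks. The undirected flip-graph is encoded as a digraph with both orientations of
  every edge. It depends on the polygon only through its vertex set.\<close>

definition flip :: "(real^2) set set \<Rightarrow> (real^2) set set \<Rightarrow> bool" where
  "flip S T \<longleftrightarrow> card (S - T) = 1 \<and> card (T - S) = 1"

definition flip_graph ::
    "(real^2) set \<Rightarrow> ((real^2) set set, (real^2) set set \<times> (real^2) set set) pre_digraph" where
  "flip_graph X =
     \<lparr> verts = {T. triangulation X T},
       arcs = {(S, T). triangulation X S \<and> triangulation X T \<and> flip S T},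
       tail = fst, head = snd \<rparr>"

lemma wf_digraph_flip_graph: "wf_digraph (flip_graph X)"
  by unfold_locales (auto simp: flip_graph_def)

lemma symmetric_flip_graph: "symmetric (flip_graph X)"
  by (auto simp: symmetric_def sym_def arcs_ends_def arc_to_ends_def flip_graph_def flip_def
      image_iff)

text \<open>Graph distance is the library's weighted distance with all arc weights equal to one.\<close>

definition geodesic :: "('a, 'b) pre_digraph \<Rightarrow> 'a list \<Rightarrow> bool" where
  "geodesic G p \<longleftrightarrow>
     vpath p G \<and> ereal (real (vwalk_length p)) = wf_digraph.\<mu> G (\<lambda>_. 1) (hd p) (last p)"

definition triangle_edges :: "real^2 \<Rightarrow> real^2 \<Rightarrow> real^2 \<Rightarrow> (real^2) set set" where
  "triangle_edges a b c = {closed_segment a b, closed_segment b c, closed_segment c a}"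

end

theory Submission
  imports Defs
begin

text \<open>Number the vertices of the polygon cyclically. Moving all vertices strictly on one side of
  an arc \<open>pq\<close> to its endpoint \<open>p\<close> turns triangulations into triangulations, and turns a
  flip into a flip or into nothing; the flip survives only if the four endpoints of the two exchanged
  arcs keep distinct images.

  Suppose the edges of the triangle \<open>abc\<close> all occur along the path but never together, and take a
  shortest subpath on which they all occur. It starts at the last triangulation with one edge, say
  \<open>ab\<close>, meets a second edge at time \<open>m\<close>, and ends at the first triangulation with the third
  edge. Let \<open>S\<close> contain \<open>abc\<close> and agree, beyond each edge, with the triangulation of the subpath
  singled out for that edge. Contracting beyond \<open>ab\<close> (and, from time \<open>m\<close> on, also beyond the
  second edge) maps the subpath to a path from its start to \<open>S\<close>; contracting beyond the third edge
  (and, before time \<open>m\<close>, also beyond the second) gives a path from \<open>S\<close> to its end. At each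
  time the two contractions together collapse all three outer regions, so by the pigeonhole principle
  no flip survives in both, and if each region is pushed to the right endpoint the first flip survives
  in neither. The detour through \<open>S\<close> is therefore shorter than the subpath.\<close>

section \<open>Separation and contractions\<close>

definition btw :: "int \<Rightarrow> int \<Rightarrow> int \<Rightarrow> bool" where
  "btw x y u \<longleftrightarrow> x < u \<and> u < y \<or> y < u \<and> u < x"

text \<open>Crossing of the chords \<open>xy\<close> and \<open>uv\<close> of a circle whose points
  are numbered cyclically: of the two arcs cut out by \<open>x\<close> and \<open>y\<close>, one is
  the linear interval between them.\<close>

definition sep :: "int \<Rightarrow> int \<Rightarrow> int \<Rightarrow> int \<Rightarrow> bool" where
  "sep x y u v \<longleftrightarrow> u \<noteq> x \<and> u \<noteq> y \<and> v \<noteq> x \<and> v \<noteq> y \<and> btw x y u \<noteq> btw x y v"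

lemma sep_commute1: "sep x y u v \<longleftrightarrow> sep y x u v"
  by (auto simp: sep_def btw_def)

lemma sep_commute2: "sep x y u v \<longleftrightarrow> sep x y v u"
  by (auto simp: sep_def btw_def)

lemma sep_swap: "sep x y u v \<longleftrightarrow> sep u v x y"
  unfolding sep_def btw_def by (smt (z3))

lemma sep_distinct: "sep x y u v \<Longrightarrow> distinct [x, y, u, v]"
  by (auto simp: sep_def btw_def)

lemma sep_total: "x \<noteq> y \<Longrightarrow> x \<noteq> u \<Longrightarrow> x \<noteq> v \<Longrightarrow> y \<noteq> u \<Longrightarrow> y \<noteq> v \<Longrightarrow> u \<noteq> v \<Longrightarrow> sep x y u v \<or> sep x u y v \<or> sep x v y u"
  unfolding sep_def btw_def by (smt (z3))

lemma sep_exclusive: "sep x y u v \<Longrightarrow> \<not> sep x u y v"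
  unfolding sep_def btw_def by (smt (z3))

text \<open>Let o be the point where \<open>uv\<close> and \<open>ij\<close> meet. The chord
  \<open>xw\<close> enters the triangle u o j through \<open>uj\<close>; it cannot leave through
  \<open>uv\<close>, so it leaves through \<open>ij\<close>.\<close>

lemma sep_pivot: "sep u v i j \<Longrightarrow> sep x w u j \<Longrightarrow> \<not> sep x w u v \<Longrightarrow> sep x w i j"
  unfolding sep_def btw_def by (smt (z3))

text \<open>Here \<open>r\<close> is a marker for the side of \<open>pq\<close> that stays fixed;
  exchanging \<open>p\<close> and \<open>q\<close> changes the endpoint that absorbs the other
  side.\<close>

definition collapse :: "int \<Rightarrow> int \<Rightarrow> int \<Rightarrow> int \<Rightarrow> int" where
  "collapse p q r v = (if sep p q v r then p else v)"

text \<open>Degree-one monotone maps of the circle: a crossing stays a crossing unless the two pairs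
  acquire a common point.\<close>

definition sep_mono :: "(int \<Rightarrow> int) \<Rightarrow> bool" where
  "sep_mono f \<longleftrightarrow> (\<forall>x y u v. sep x y u v \<longrightarrow>
     f x = f u \<or> f x = f v \<or> f y = f u \<or> f y = f v \<or> sep (f x) (f y) (f u) (f v))"

lemma sep_collapse_one:
  assumes "sep x y u v" "sep p q x r" "\<not> sep p q u r" "\<not> sep p q v r" "\<not> sep p q y r" "u \<noteq> p" "v \<noteq> p"
  shows "sep p y u v"
  using assms unfolding sep_def btw_def by (smt (z3))

lemma sep_collapse_two:
  assumes "sep x y u v" "sep p q x r" "sep p q y r" "\<not> sep p q u r" "\<not> sep p q v r"
  shows "u = p \<or> v = p"
  using assms unfolding sep_def btw_def by (smt (z3))

text \<open>If points of both chords move, they meet at \<open>p\<close>. A single moving point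
  keeps its position relative to the other chord unless that chord ends at \<open>p\<close>. A chord
  whose two ends both move lies beyond \<open>pq\<close>, where no chord with unmoved ends crosses
  it.\<close>

lemma sep_mono_collapse: "sep_mono (collapse p q r)"
proof -
  have "collapse p q r x = collapse p q r u \<or> collapse p q r x = collapse p q r v \<or>
      collapse p q r y = collapse p q r u \<or> collapse p q r y = collapse p q r v \<or>
      sep (collapse p q r x) (collapse p q r y) (collapse p q r u) (collapse p q r v)"
    if s: "sep x y u v" for x y u v
  proof -
    have s': "sep y x u v" "sep u v x y" "sep v u x y"
      using s sep_commute1 sep_commute2 sep_swap by blast+
    have s'': "sep x p u v \<longleftrightarrow> sep p x u v" "sep x y u p \<longleftrightarrow> sep p u x y" "sep x y p v \<longleftrightarrow> sep p v x y"
      using sep_commute1 sep_commute2 sep_swap by blast+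
    show ?thesis
      using sep_collapse_one[of x y u v p q r] sep_collapse_one[of y x u v p q r]
        sep_collapse_one[of u v x y p q r] sep_collapse_one[of v u x y p q r]
        sep_collapse_two[of x y u v p q r] sep_collapse_two[of u v x y p q r] s s' s''
      unfolding collapse_def by (smt (z3))
  qed
  then show ?thesis
    unfolding sep_mono_def by blast
qed

section \<open>Triangulations as symmetric relations\<close>

text \<open>The arc between \<open>x\<close> and \<open>y\<close> is represented by both pairs \<open>(x, y)\<close> and
  \<open>(y, x)\<close>; the sides of the polygon on \<open>Y\<close> are included.\<close>

definition tri :: "int set \<Rightarrow> (int \<times> int) set \<Rightarrow> bool" where
  "tri Y T \<longleftrightarrow> (\<forall>x y. (x, y) \<in> T \<longrightarrow> x \<in> Y \<and> y \<in> Y \<and> x \<noteq> y \<and> (y, x) \<in> T) \<and>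
     (\<forall>x y u v. (x, y) \<in> T \<longrightarrow> (u, v) \<in> T \<longrightarrow> \<not> sep x y u v) \<and>
     (\<forall>x\<in>Y. \<forall>y\<in>Y. x \<noteq> y \<longrightarrow> (\<forall>u v. (u, v) \<in> T \<longrightarrow> \<not> sep x y u v) \<longrightarrow> (x, y) \<in> T)"

lemma tri_in: "tri Y T \<Longrightarrow> (x, y) \<in> T \<Longrightarrow> x \<in> Y \<and> y \<in> Y \<and> x \<noteq> y \<and> (y, x) \<in> T"
  unfolding tri_def by (elim conjE) iprover

lemma tri_noncrossing: "tri Y T \<Longrightarrow> (x, y) \<in> T \<Longrightarrow> (u, v) \<in> T \<Longrightarrow> \<not> sep x y u v"
  unfolding tri_def by (elim conjE) iprover

lemma tri_maximal:
  assumes "tri Y T" "x \<in> Y" "y \<in> Y" "x \<noteq> y" "\<And>u v. (u, v) \<in> T \<Longrightarrow> \<not> sep x y u v"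
  shows "(x, y) \<in> T"
proof -
  have "\<forall>x\<in>Y. \<forall>y\<in>Y. x \<noteq> y \<longrightarrow> (\<forall>u v. (u, v) \<in> T \<longrightarrow> \<not> sep x y u v) \<longrightarrow> (x, y) \<in> T"
    using assms(1) unfolding tri_def by (elim conjE)
  then show ?thesis
    using assms(2-5) by simp
qed

lemma triI:
  assumes "\<And>x y. (x, y) \<in> T \<Longrightarrow> x \<in> Y \<and> y \<in> Y \<and> x \<noteq> y \<and> (y, x) \<in> T"
    and "\<And>x y u v. (x, y) \<in> T \<Longrightarrow> (u, v) \<in> T \<Longrightarrow> \<not> sep x y u v"
    and "\<And>x y. x \<in> Y \<Longrightarrow> y \<in> Y \<Longrightarrow> x \<noteq> y \<Longrightarrow> (\<And>u v. (u, v) \<in> T \<Longrightarrow> \<not> sep x y u v) \<Longrightarrow> (x, y) \<in> T"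
  shows "tri Y T"
  unfolding tri_def using assms by (intro conjI allI impI ballI) iprover+

lemma tri_sym: "tri Y T \<Longrightarrow> sym T"
  by (auto intro: symI dest: tri_in)

lemma tri_subset: "tri Y T \<Longrightarrow> T \<subseteq> Y \<times> Y"
  by (auto dest: tri_in)

lemma tri_subset_eq:
  assumes "tri Y S" "tri Y S'" "S \<subseteq> S'"
  shows "S = S'"
proof -
  have "(x, y) \<in> S" if "(x, y) \<in> S'" for x y
    using tri_maximal[OF assms(1)] tri_in[OF assms(2)] tri_noncrossing[OF assms(2)] that assms(3) by blast
  then show ?thesis
    using assms(3) by auto
qed

text \<open>Distinct maximal sets do not contain each other, so both differences are full. If
  \<open>xy\<close> and \<open>uv\<close> did not cross, \<open>uv\<close> could be added to
  \<open>A\<close>.\<close>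

lemma tri_eq_or_flip:
  assumes A: "tri X A" and B: "tri X B"
    and AB: "A - B \<subseteq> {(x, y), (y, x)}" and BA: "B - A \<subseteq> {(u, v), (v, u)}"
  shows "A = B \<or> A - B = {(x, y), (y, x)} \<and> B - A = {(u, v), (v, u)} \<and> sep x y u v"
proof (cases "A = B")
  case False
  then have "\<not> A \<subseteq> B" "\<not> B \<subseteq> A"
    using tri_subset_eq[OF A B] tri_subset_eq[OF B A] by auto
  then have xy: "A - B = {(x, y), (y, x)}" and uv: "B - A = {(u, v), (v, u)}"
    using AB BA tri_in[OF A] tri_in[OF B] by blast+
  then have uvB: "(u, v) \<in> B" "(u, v) \<notin> A"
    by blast+
  have "sep x y u v"
  proof (rule ccontr)
    assume "\<not> sep x y u v"
    then have "\<not> sep u v s t" if "(s, t) \<in> A" for s t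
    proof (cases "(s, t) \<in> B")
      case True
      then show ?thesis
        using tri_noncrossing[OF B uvB(1)] by blast
    next
      case False
      then have "(s, t) \<in> A - B"
        using that by blast
      then have "(s, t) = (x, y) \<or> (s, t) = (y, x)"
        unfolding xy by blast
      then show ?thesis
        using \<open>\<not> sep x y u v\<close> sep_commute2[of u v x y] sep_swap[of u v x y] by (metis prod.inject)
    qed
    then have "(u, v) \<in> A"
      using tri_maximal[OF A] tri_in[OF B uvB(1)] by blast
    then show False
      using uvB by blast
  qed
  then show ?thesis
    using xy uv by blast
qed simp

section \<open>Images of triangulations under monotone maps\<close>

definition img :: "(int \<Rightarrow> int) \<Rightarrow> (int \<times> int) set \<Rightarrow> (int \<times> int) set" where
  "img f T = {(f x, f y) | x y. (x, y) \<in> T \<and> f x \<noteq> f y}"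

lemma img_comp: "img (g \<circ> f) T = img g (img f T)"
  unfolding img_def by fastforce

lemma img_diff: "T - T' \<subseteq> {(x, y), (y, x)} \<Longrightarrow> img f T - img f T' \<subseteq> {(f x, f y), (f y, f x)}"
  unfolding img_def by blast

text \<open>Among the pairs lying over \<open>(p, q)\<close>, one crossed by as few arcs of \<open>T\<close> as possible is in
  \<open>T\<close>: replacing an endpoint by the endpoint, in the same fibre, of a crossing arc would lower the
  number of crossings, and a crossing arc with no endpoint in the two fibres maps to an arc
  crossing \<open>(p, q)\<close>.\<close>

lemma tri_img_lift:
  assumes T: "tri X T" and fin: "finite X" and f: "sep_mono f"
    and p: "p \<in> f ` X" and q: "q \<in> f ` X" and "p \<noteq> q"
    and uncrossed: "\<And>u v. (u, v) \<in> img f T \<Longrightarrow> \<not> sep p q u v"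
  shows "\<exists>i j. (i, j) \<in> T \<and> f i = p \<and> f j = q"
proof -
  define N where "N = (\<lambda>(i, j). card {(s, t) \<in> T. sep i j s t})"
  define Q where "Q = (\<lambda>(i, j). i \<in> X \<and> j \<in> X \<and> f i = p \<and> f j = q)"
  have finT: "finite T"
    using tri_subset[OF T] fin by (meson finite_SigmaI finite_subset)
  obtain ij where "Q ij"
    using p q unfolding Q_def by auto
  then obtain ij where ij: "Q ij" and min: "\<And>e. Q e \<Longrightarrow> N ij \<le> N e"
    using ex_has_least_nat[of Q ij N] by blast
  obtain i j where [simp]: "ij = (i, j)"
    by fastforce
  have i: "i \<in> X" "f i = p" and j: "j \<in> X" "f j = q"
    using ij unfolding Q_def by auto
  \<comment> \<open>An arc of \<open>T\<close> crossing \<open>uj\<close> cannot cross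
    \<open>uv\<close>, so \<open>sep_pivot\<close> makes it cross \<open>ij\<close>; the inclusion
    is strict because \<open>uv\<close> crosses \<open>ij\<close> but not \<open>uj\<close>.\<close>
  have less: "N (u, j) < N (i, j)" if "(u, v) \<in> T" "sep i j u v" for i j u v
    unfolding N_def prod.case
  proof (rule psubset_card_mono)
    show "finite {(s, t) \<in> T. sep i j s t}"
      using finT by (rule rev_finite_subset) auto
    have "sep i j s t" if "(s, t) \<in> T" "sep u j s t" for s t
      using that tri_noncrossing[OF T that(1) \<open>(u, v) \<in> T\<close>] sep_pivot[of u v i j s t] \<open>sep i j u v\<close>
        sep_swap by blast
    moreover have "\<not> sep u j u v"
      using sep_distinct by auto
    ultimately show "{(s, t) \<in> T. sep u j s t} \<subset> {(s, t) \<in> T. sep i j s t}"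
      using that by blast
  qed
  have sw: "N (x, y) = N (y, x)" for x y
    unfolding N_def using sep_commute1 by simp
  have "(i, j) \<in> T"
  proof (rule ccontr)
    assume "(i, j) \<notin> T"
    then obtain u v where uv: "(u, v) \<in> T" "sep i j u v"
      using tri_maximal[OF T i(1) j(1)] i j \<open>p \<noteq> q\<close> by blast
    have vu: "(v, u) \<in> T" "sep i j v u" "sep j i u v" "sep j i v u" and X: "u \<in> X" "v \<in> X"
      using uv tri_in[OF T] sep_commute1 sep_commute2 by blast+
    have "f w \<noteq> p" if "w = u \<or> w = v" for w
      using less[OF uv] less[OF vu(1,2)] min[of "(w, j)"] that X j unfolding Q_def by auto
    moreover have "f w \<noteq> q" if "w = u \<or> w = v" for w
      using less[OF uv(1) vu(3)] less[OF vu(1,4)] sw min[of "(i, w)"] that X i unfolding Q_def by auto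
    ultimately have "sep p q (f u) (f v)"
      using f uv(2) i j unfolding sep_mono_def by metis
    moreover have "(f u, f v) \<in> img f T"
      using uv(1) sep_distinct[OF \<open>sep p q (f u) (f v)\<close>] unfolding img_def by auto
    ultimately show False
      using uncrossed by blast
  qed
  then show ?thesis
    using i j by blast
qed

text \<open>If two image arcs crossed, the four preimages of their ends would be distinct and cross
  in one of the other two pairings. A monotone map preserves that crossing, but four points cross in
  only one pairing. Maximality is \<open>tri_img_lift\<close>.\<close>

lemma tri_img:
  assumes T: "tri X T" and fin: "finite X" and f: "sep_mono f"
  shows "tri (f ` X) (img f T)"
proof (rule triI)
  show "x \<in> f ` X \<and> y \<in> f ` X \<and> x \<noteq> y \<and> (y, x) \<in> img f T" if xy: "(x, y) \<in> img f T" for x y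
  proof -
    obtain x' y' where "x = f x'" "y = f y'" "(x', y') \<in> T" "f x' \<noteq> f y'"
      using xy unfolding img_def by blast
    then show ?thesis
      using tri_in[OF T, of x' y'] unfolding img_def by force
  qed
  show "\<not> sep x y u v" if xy: "(x, y) \<in> img f T" and uv: "(u, v) \<in> img f T" for x y u v
  proof
    assume s: "sep x y u v"
    obtain x' y' where x': "x = f x'" "y = f y'" "(x', y') \<in> T"
      using xy unfolding img_def by blast
    obtain u' v' where u': "u = f u'" "v = f v'" "(u', v') \<in> T"
      using uv unfolding img_def by blast
    have d: "distinct [f x', f y', f u', f v']"
      using sep_distinct[OF s] x' u' by simp
    then have "sep x' u' y' v' \<or> sep x' v' y' u'"
      using sep_total[of x' y' u' v'] tri_noncrossing[OF T x'(3) u'(3)] by auto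
    then have "sep x u y v \<or> sep x v y u"
      using f d x' u' unfolding sep_mono_def by (metis distinct_length_2_or_more)
    then show False
      using sep_exclusive s sep_commute2 by blast
  qed
  show "(x, y) \<in> img f T" if xy: "x \<in> f ` X" "y \<in> f ` X" "x \<noteq> y"
    and uncrossed: "\<And>u v. (u, v) \<in> img f T \<Longrightarrow> \<not> sep x y u v" for x y
  proof -
    obtain i j where "(i, j) \<in> T" "f i = x" "f j = y"
      using tri_img_lift[OF T fin f xy uncrossed] by blast
    then show ?thesis
      using \<open>x \<noteq> y\<close> unfolding img_def by blast
  qed
qed

section \<open>Cutting and gluing along an arc\<close>

definition side :: "int set \<Rightarrow> int \<Rightarrow> int \<Rightarrow> int \<Rightarrow> int set" where
  "side X p q r = {v \<in> X. sep p q v r}"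

lemma sep_across:
  assumes "\<not> sep p q x y" "\<not> sep p q u v"
    and "x = p \<or> x = q \<or> sep p q x r" "y = p \<or> y = q \<or> sep p q y r"
    and "\<not> sep p q u r" "\<not> sep p q v r" "r \<noteq> p" "r \<noteq> q" "p \<noteq> q"
  shows "\<not> sep x y u v"
  using assms unfolding sep_def btw_def by (smt (z3))

lemma tri_side_edge:
  assumes "tri (X - side X p q r) P" "p \<in> X" "q \<in> X" "p \<noteq> q" "r \<noteq> p" "r \<noteq> q"
  shows "(p, q) \<in> P"
proof (rule tri_maximal[OF assms(1)])
  show "\<not> sep p q u v" if "(u, v) \<in> P" for u v
    using tri_in[OF assms(1) that] assms(5,6) unfolding side_def sep_def by blast
qed (use assms in \<open>auto simp: side_def sep_def\<close>)

text \<open>Both pieces contain \<open>pq\<close>. Hence arcs of different pieces do not cross, and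
  an arc crossed by neither piece does not cross \<open>pq\<close>, so it lies within one piece,
  whose maximality applies.\<close>

lemma tri_glue:
  assumes U: "tri (side X p q r \<union> {p, q}) U" and pqU: "(p, q) \<in> U"
    and P: "tri (X - side X p q r) P"
    and pq: "p \<in> X" "q \<in> X" "p \<noteq> q" "r \<noteq> p" "r \<noteq> q"
  shows "tri X (U \<union> P)"
proof (rule triI)
  have pqP: "(p, q) \<in> P"
    using tri_side_edge[OF P pq] .
  show "x \<in> X \<and> y \<in> X \<and> x \<noteq> y \<and> (y, x) \<in> U \<union> P" if "(x, y) \<in> U \<union> P" for x y
    using that tri_in[OF U, of x y] tri_in[OF P, of x y] pq unfolding side_def by blast
  have UP: "\<not> sep x y u v" if xy: "(x, y) \<in> U" and uv: "(u, v) \<in> P" for x y u v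
  proof (rule sep_across[where p = p and q = q and r = r])
    show "\<not> sep p q x y" "\<not> sep p q u v"
      using tri_noncrossing[OF U pqU xy] tri_noncrossing[OF P pqP uv] .
    show "x = p \<or> x = q \<or> sep p q x r" "y = p \<or> y = q \<or> sep p q y r"
      using tri_in[OF U xy] unfolding side_def by blast+
    show "\<not> sep p q u r" "\<not> sep p q v r"
      using tri_in[OF P uv] unfolding side_def by blast+
  qed (use pq in auto)
  show "\<not> sep x y u v" if "(x, y) \<in> U \<union> P" "(u, v) \<in> U \<union> P" for x y u v
    using that UP[of x y u v] UP[of u v x y] tri_noncrossing[OF U, of x y u v]
      tri_noncrossing[OF P, of x y u v] sep_swap[of x y u v] by blast
  show "(x, y) \<in> U \<union> P" if xy: "x \<in> X" "y \<in> X" "x \<noteq> y"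
    and uncrossed: "\<And>u v. (u, v) \<in> U \<union> P \<Longrightarrow> \<not> sep x y u v" for x y
  proof -
    have "\<not> sep p q x y"
      using uncrossed[of p q] pqU sep_swap by blast
    then have "(x \<in> side X p q r \<union> {p, q} \<and> y \<in> side X p q r \<union> {p, q})
        \<or> (x \<in> X - side X p q r \<and> y \<in> X - side X p q r)"
      using xy pq unfolding side_def sep_def by blast
    then show ?thesis
    proof (elim disjE conjE)
      assume "x \<in> side X p q r \<union> {p, q}" "y \<in> side X p q r \<union> {p, q}"
      then have "(x, y) \<in> U"
        by (rule tri_maximal[OF U _ _ xy(3)]) (rule uncrossed, rule UnI1)
      then show ?thesis ..
    next
      assume "x \<in> X - side X p q r" "y \<in> X - side X p q r"
      then have "(x, y) \<in> P"
        by (rule tri_maximal[OF P _ _ xy(3)]) (rule uncrossed, rule UnI2)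
      then show ?thesis ..
    qed
  qed
qed

text \<open>An arc of \<open>T\<close> not contained in the closed side lies on the other side of
  \<open>pq\<close> and crosses nothing in \<open>Z\<close>, so maximality within \<open>Z\<close>
  follows from that of \<open>T\<close>.\<close>

lemma tri_restrict:
  assumes T: "tri X T" and pqT: "(p, q) \<in> T" and r: "r \<noteq> p" "r \<noteq> q"
  defines "Z \<equiv> side X p q r \<union> {p, q}"
  shows "tri Z (T \<inter> Z \<times> Z)"
proof (rule triI)
  have pq: "p \<in> X" "q \<in> X" "p \<noteq> q"
    using tri_in[OF T pqT] by auto
  show "x \<in> Z \<and> y \<in> Z \<and> x \<noteq> y \<and> (y, x) \<in> T \<inter> Z \<times> Z" if "(x, y) \<in> T \<inter> Z \<times> Z" for x y
    using that tri_in[OF T] by blast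
  show "\<not> sep x y u v" if "(x, y) \<in> T \<inter> Z \<times> Z" "(u, v) \<in> T \<inter> Z \<times> Z" for x y u v
    using that tri_noncrossing[OF T] by blast
  show "(x, y) \<in> T \<inter> Z \<times> Z" if xy: "x \<in> Z" "y \<in> Z" "x \<noteq> y"
    and uncrossed: "\<And>u v. (u, v) \<in> T \<inter> Z \<times> Z \<Longrightarrow> \<not> sep x y u v" for x y
  proof -
    have "\<not> sep x y u v" if uv: "(u, v) \<in> T" for u v
    proof (cases "u \<in> Z \<and> v \<in> Z")
      case True
      then show ?thesis
        using uncrossed uv by blast
    next
      case False
      have uvX: "u \<in> X" "v \<in> X" "\<not> sep p q u v"
        using tri_in[OF T uv] tri_noncrossing[OF T pqT uv] by auto
      have "\<not> sep p q x y"
        using uncrossed[of p q] pqT sep_swap unfolding Z_def by blast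
      moreover have "\<not> sep p q u r" "\<not> sep p q v r"
        using False uvX unfolding Z_def side_def sep_def by blast+
      ultimately show ?thesis
        using sep_across[of p q x y u v r] uvX xy(1,2) pq r unfolding Z_def side_def by blast
    qed
    moreover have "x \<in> X" "y \<in> X"
      using xy(1,2) pq unfolding Z_def side_def by auto
    ultimately have "(x, y) \<in> T"
      using tri_maximal[OF T _ _ xy(3)] by blast
    then show ?thesis
      using xy by blast
  qed
qed

lemma tri_img_collapse:
  assumes "tri X T" "finite X" "p \<in> X"
  shows "tri (X - side X p q r) (img (collapse p q r) T)"
proof -
  have "collapse p q r ` X = X - side X p q r"
    using assms(3) unfolding collapse_def side_def sep_def by (auto simp: image_iff)
  then show ?thesis
    using tri_img[OF assms(1,2) sep_mono_collapse, of p q r] by simp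
qed

text \<open>Since \<open>pq\<close> is in \<open>T\<close>, an arc with an end beyond
  \<open>pq\<close> has its other end beyond as well or at \<open>p\<close> or \<open>q\<close>, so
  its image is degenerate or \<open>pq\<close>. All other arcs are fixed.\<close>

lemma img_collapse_subset:
  assumes T: "tri X T" and pqT: "(p, q) \<in> T"
  shows "img (collapse p q r) T \<subseteq> T"
proof -
  have *: "(collapse p q r x, collapse p q r y) \<in> T"
    if xy: "(x, y) \<in> T" and ne: "collapse p q r x \<noteq> collapse p q r y" for x y
  proof -
    have "\<not> sep p q x y"
      using tri_noncrossing[OF T pqT xy] .
    then show ?thesis
      using xy ne pqT tri_in[OF T pqT] unfolding collapse_def sep_def by (auto split: if_splits)
  qed
  then show ?thesis
    unfolding img_def by blast
qed

section \<open>The two contracted paths\<close>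

lemma sep_sides_disjoint:
  assumes "sep a b v c" "a \<noteq> b" "b \<noteq> c" "c \<noteq> a"
  shows "\<not> sep b c v a" "\<not> sep c a v b"
  using assms unfolding sep_def btw_def by (smt (z3))+

lemma sep_sides_cover:
  assumes "a \<noteq> b" "b \<noteq> c" "c \<noteq> a" "v \<noteq> a" "v \<noteq> b" "v \<noteq> c"
  shows "sep a b v c \<or> sep b c v a \<or> sep c a v b"
  using assms unfolding sep_def btw_def by (smt (z3))

definition flips :: "int set \<Rightarrow> ((int \<times> int) set \<times> (int \<times> int) set) set" where
  "flips X = {(A, B). tri X A \<and> tri X B \<and>
     (\<exists>x y u v. A - B = {(x, y), (y, x)} \<and> B - A = {(u, v), (v, u)})}"

lemma flips_sym: "(A, B) \<in> flips X \<Longrightarrow> (B, A) \<in> flips X"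
  unfolding flips_def by blast

lemma relpow_stuttering:
  assumes "\<And>i. i < k \<Longrightarrow> D i = D (Suc i) \<or> (D i, D (Suc i)) \<in> R"
  shows "(D 0, D k) \<in> R ^^ card {i. i < k \<and> D i \<noteq> D (Suc i)}"
  using assms
proof (induction k)
  case (Suc k)
  have IH: "(D 0, D k) \<in> R ^^ card {i. i < k \<and> D i \<noteq> D (Suc i)}"
    using Suc by simp
  show ?case
  proof (cases "D k = D (Suc k)")
    case True
    then have "{i. i < Suc k \<and> D i \<noteq> D (Suc i)} = {i. i < k \<and> D i \<noteq> D (Suc i)}"
      by (auto simp: less_Suc_eq)
    then show ?thesis
      using IH True by simp
  next
    case False
    then have "{i. i < Suc k \<and> D i \<noteq> D (Suc i)} = insert k {i. i < k \<and> D i \<noteq> D (Suc i)}"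
      by (auto simp: less_Suc_eq)
    then show ?thesis
      using IH False Suc.prems[of k] by auto
  qed
qed simp

text \<open>The letters m and l mark the middle and the last edge; \<open>rm\<close> and
  \<open>rl\<close> are the opposite corners. Both cases of \<open>ml\<close> keep the cyclic
  orientation \<open>abc\<close>, so the three regions are contracted to three different
  corners.\<close>

locale tri_path =
  fixes X :: "int set" and T :: "nat \<Rightarrow> (int \<times> int) set" and k m :: nat
    and a b c pm qm rm pl ql rl :: int
  assumes fin: "finite X" and abcX: "a \<in> X" "b \<in> X" "c \<in> X" and abc: "a \<noteq> b" "b \<noteq> c" "c \<noteq> a"
    and ml: "(pm, qm, rm, pl, ql, rl) = (b, c, a, c, a, b) \<or> (pm, qm, rm, pl, ql, rl) = (c, a, b, b, c, a)"
    and T: "\<And>i. i \<le> k \<Longrightarrow> tri X (T i)" and mk: "m \<le> k"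
    and ab0: "(a, b) \<in> T 0" and pqm: "(pm, qm) \<in> T m" and pql: "(pl, ql) \<in> T k"
begin

definition "Z0 = side X a b c \<union> {a, b}"
definition "Zm = side X pm qm rm \<union> {pm, qm}"
definition "Zl = side X pl ql rl \<union> {pl, ql}"

definition "S = T 0 \<inter> Z0 \<times> Z0 \<union> T m \<inter> Zm \<times> Zm \<union> T k \<inter> Zl \<times> Zl"

abbreviation "\<kappa>0 \<equiv> collapse a b c"
abbreviation "\<kappa>m \<equiv> collapse pm qm rm"

text \<open>The path \<open>D\<close> follows \<open>A1\<close> up to time \<open>m\<close> and \<open>A2\<close> afterwards; both agree
  at time \<open>m\<close>. Running the same construction on the reversed path, with the first and the third
  edge exchanged, gives the second half of the detour.\<close>

definition "A1 i = T 0 \<inter> Z0 \<times> Z0 \<union> img \<kappa>0 (T i)"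
definition "A2 i = T 0 \<inter> Z0 \<times> Z0 \<union> (T m \<inter> Zm \<times> Zm \<union> img \<kappa>m (img \<kappa>0 (T i)))"
definition "D i = (if i < m then A1 i else A2 i)"
text \<open>One map serves both ends of step \<open>i\<close>, including the step that arrives at
  time \<open>m\<close>, because \<open>A1\<close> and \<open>A2\<close> agree there.\<close>

definition "F i = (if i < m then \<kappa>0 else \<kappa>m \<circ> \<kappa>0)"

lemma pqr: "{pm, qm, rm} = {a, b, c}" "{pl, ql, rl} = {a, b, c}" "pm \<noteq> qm" "rm \<noteq> pm" "rm \<noteq> qm"
    "pl \<noteq> ql" "rl \<noteq> pl" "rl \<noteq> ql" "pm \<in> X" "qm \<in> X" "pl \<in> X" "ql \<in> X"
  using ml abc abcX by auto

lemma sides_disjoint: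
  "sep a b v c \<Longrightarrow> \<not> sep pm qm v rm" "sep a b v c \<Longrightarrow> \<not> sep pl ql v rl"
  "sep pm qm v rm \<Longrightarrow> \<not> sep pl ql v rl"
  using ml sep_sides_disjoint[of a b v c] sep_sides_disjoint[of b c v a] abc
  unfolding prod.inject by metis+

lemma sides_cover:
  "v \<notin> {a, b, c} \<Longrightarrow> sep a b v c \<or> sep pm qm v rm \<or> sep pl ql v rl"
  using ml sep_sides_cover[of a b c v] abc unfolding prod.inject insert_iff by metis

lemma corner_not_side: "v \<in> {a, b, c} \<Longrightarrow> \<not> sep a b v c \<and> \<not> sep pm qm v rm \<and> \<not> sep pl ql v rl"
  using ml unfolding sep_def by auto

lemma tri_A1:
  assumes "i \<le> k"
  shows "tri X (A1 i)"
  unfolding A1_def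
proof (rule tri_glue)
  show "tri (side X a b c \<union> {a, b}) (T 0 \<inter> Z0 \<times> Z0)"
    unfolding Z0_def using tri_restrict[OF T ab0] abc by auto
  show "(a, b) \<in> T 0 \<inter> Z0 \<times> Z0"
    using ab0 unfolding Z0_def by auto
  show "tri (X - side X a b c) (img \<kappa>0 (T i))"
    by (rule tri_img_collapse) (use T assms fin abcX in auto)
qed (use abcX abc in auto)

lemma tri_A2:
  assumes "i \<le> k"
  shows "tri X (A2 i)"
  unfolding A2_def
proof (rule tri_glue)
  let ?X = "X - side X a b c"
  \<comment> \<open>The outer regions are disjoint, so contracting beyond \<open>ab\<close> leaves
    the vertices of the middle region intact.\<close>
  have side: "side ?X pm qm rm = side X pm qm rm"
    unfolding side_def using sides_disjoint by auto
  have pX: "pm \<in> ?X" "qm \<in> ?X"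
    using corner_not_side[of pm] corner_not_side[of qm] pqr unfolding side_def by auto
  have P: "tri ?X (img \<kappa>0 (T i))"
    by (rule tri_img_collapse) (use T assms fin abcX in auto)
  show "tri (side X a b c \<union> {a, b}) (T 0 \<inter> Z0 \<times> Z0)"
    unfolding Z0_def using tri_restrict[OF T ab0] abc by auto
  show "(a, b) \<in> T 0 \<inter> Z0 \<times> Z0"
    using ab0 unfolding Z0_def by auto
  show "tri ?X (T m \<inter> Zm \<times> Zm \<union> img \<kappa>m (img \<kappa>0 (T i)))"
  proof (rule tri_glue)
    show "tri (side ?X pm qm rm \<union> {pm, qm}) (T m \<inter> Zm \<times> Zm)"
      unfolding side Zm_def using tri_restrict[OF T[OF mk] pqm] pqr by auto
    show "(pm, qm) \<in> T m \<inter> Zm \<times> Zm"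
      using pqm unfolding Zm_def by auto
    show "tri (?X - side ?X pm qm rm) (img \<kappa>m (img \<kappa>0 (T i)))"
      by (rule tri_img_collapse[OF P]) (use fin pX in auto)
  qed (use pX pqr in auto)
qed (use abcX abc in auto)

lemma \<kappa>0_fixed: "\<not> sep a b v c \<Longrightarrow> \<kappa>0 v = v"
  and \<kappa>m_fixed: "\<not> sep pm qm v rm \<Longrightarrow> \<kappa>m v = v"
  unfolding collapse_def by auto

lemma Zm_fixed: "v \<in> Zm \<Longrightarrow> \<kappa>0 v = v"
  using sides_disjoint(1)[of v] corner_not_side[of v] pqr(1)
  by (intro \<kappa>0_fixed) (auto simp: Zm_def side_def)

lemma Zl_fixed: "v \<in> Zl \<Longrightarrow> \<kappa>0 v = v \<and> \<kappa>m v = v"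
  using sides_disjoint(2,3)[of v] corner_not_side[of v] pqr(2) \<kappa>0_fixed \<kappa>m_fixed
  by (auto simp: Zl_def side_def)

lemma img_fixed: "(x, y) \<in> U \<Longrightarrow> x \<noteq> y \<Longrightarrow> f x = x \<Longrightarrow> f y = y \<Longrightarrow> (x, y) \<in> img f U"
  unfolding img_def by (intro CollectI exI[of _ x] exI[of _ y]) simp

text \<open>At time \<open>m\<close> the middle edge is present, so contracting beyond it merely
  deletes the arcs there, and these are put back from \<open>T m\<close>. One inclusion suffices
  between triangulations.\<close>

lemma A1_m: "A1 m = A2 m"
proof (rule tri_subset_eq[OF tri_A2[OF mk] tri_A1[OF mk], symmetric])
  have P: "tri (X - side X a b c) (img \<kappa>0 (T m))"
    by (rule tri_img_collapse) (use T mk fin abcX in auto)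
  have "(pm, qm) \<in> img \<kappa>0 (T m)"
    using pqr(3) pqm Zm_fixed by (intro img_fixed) (auto simp: Zm_def)
  then have "img \<kappa>m (img \<kappa>0 (T m)) \<subseteq> img \<kappa>0 (T m)"
    by (rule img_collapse_subset[OF P])
  moreover have "T m \<inter> Zm \<times> Zm \<subseteq> img \<kappa>0 (T m)"
    using Zm_fixed tri_in[OF T[OF mk]] img_fixed by auto
  ultimately show "A2 m \<subseteq> A1 m"
    unfolding A1_def A2_def by blast
qed

lemma tri_D: "i \<le> k \<Longrightarrow> tri X (D i)"
  unfolding D_def using tri_A1 tri_A2 by auto

text \<open>Since \<open>ab\<close> lies in \<open>T 0\<close>, contracting beyond it and restoring
  the arcs there yields nothing outside \<open>T 0\<close>.\<close>

lemma D_0: "D 0 = T 0"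
proof -
  have "A1 0 \<subseteq> T 0"
    unfolding A1_def using img_collapse_subset[OF T ab0] by auto
  then have "A1 0 = T 0"
    using tri_subset_eq[OF tri_A1 T] by auto
  then show ?thesis
    using A1_m unfolding D_def by (cases "m = 0") auto
qed

lemma S_edges: "(x, y) \<in> S" if "x \<in> {a, b, c}" "y \<in> {a, b, c}" "x \<noteq> y"
proof -
  have "(a, b) \<in> S" "(b, a) \<in> S"
    using ab0 tri_in[OF T ab0] unfolding S_def Z0_def by auto
  moreover have "(pm, qm) \<in> S" "(qm, pm) \<in> S"
    using pqm tri_in[OF T[OF mk] pqm] unfolding S_def Zm_def by auto
  moreover have "(pl, ql) \<in> S" "(ql, pl) \<in> S"
    using pql tri_in[OF T pql] unfolding S_def Zl_def by auto
  ultimately show ?thesis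
    using ml that by auto
qed

text \<open>The last edge lies in \<open>T k\<close>, so an arc of \<open>T k\<close> either lies in
  \<open>Zl\<close>, where both contractions are the identity, or has no end beyond that edge; then
  both its ends are sent to corners of \<open>abc\<close>.\<close>

lemma D_k: "D k = S"
proof -
  have "A2 k \<subseteq> S"
  proof -
    have "(\<kappa>m (\<kappa>0 x), \<kappa>m (\<kappa>0 y)) \<in> S"
      if xy: "(x, y) \<in> T k" and ne: "\<kappa>m (\<kappa>0 x) \<noteq> \<kappa>m (\<kappa>0 y)" for x y
    proof (cases "x \<in> Zl \<and> y \<in> Zl")
      case True
      then show ?thesis
        using xy Zl_fixed[of x] Zl_fixed[of y] unfolding S_def by auto
    next
      case False
      have "x \<in> X" "y \<in> X" "\<not> sep pl ql x y"
        using tri_in[OF T xy] tri_noncrossing[OF T pql xy] by auto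
      then have "\<not> sep pl ql x rl" "\<not> sep pl ql y rl"
        using False unfolding Zl_def side_def sep_def by auto
      moreover have "\<kappa>m (\<kappa>0 v) \<in> {a, b, c}" if "\<not> sep pl ql v rl" for v
        using sides_cover[of v] sides_disjoint(1)[of v] corner_not_side[of a] pqr(1) that
        unfolding collapse_def by auto
      ultimately show ?thesis
        using S_edges ne by blast
    qed
    then have "img \<kappa>m (img \<kappa>0 (T k)) \<subseteq> S"
      unfolding img_def by fastforce
    then show ?thesis
      unfolding A2_def S_def by blast
  qed
  moreover have "S \<subseteq> A2 k"
  proof -
    have "T k \<inter> Zl \<times> Zl \<subseteq> img \<kappa>m (img \<kappa>0 (T k))"
      using Zl_fixed tri_in[OF T] by (auto intro!: img_fixed)
    then show ?thesis
      unfolding A2_def S_def by blast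
  qed
  ultimately show ?thesis
    using mk unfolding D_def by auto
qed

text \<open>Both ends of the step share the glued part \<open>U\<close> and are otherwise images
  under \<open>F i\<close>. The difference of the images is at most the image of the exchanged arc,
  so \<open>tri_eq_or_flip\<close> applies.\<close>

lemma D_step:
  assumes "i < k" and xy: "T i - T (Suc i) = {(x, y), (y, x)}" and uv: "T (Suc i) - T i = {(u, v), (v, u)}"
  shows "D i = D (Suc i) \<or> (D i, D (Suc i)) \<in> flips X \<and> sep (F i x) (F i y) (F i u) (F i v)"
proof -
  obtain U where U: "D i = U \<union> img (F i) (T i)" "D (Suc i) = U \<union> img (F i) (T (Suc i))"
  proof (cases "i < m")
    case True
    then have "D i = A1 i" "D (Suc i) = A1 (Suc i)" "F i = \<kappa>0"
      using A1_m unfolding D_def F_def by (auto simp: less_Suc_eq not_less_eq dest: less_antisym)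
    then show ?thesis
      using that unfolding A1_def by metis
  next
    case False
    then have DF: "D i = A2 i" "D (Suc i) = A2 (Suc i)" "F i = \<kappa>m \<circ> \<kappa>0"
      unfolding D_def F_def by auto
    then show ?thesis
      by (intro that[of "T 0 \<inter> Z0 \<times> Z0 \<union> T m \<inter> Zm \<times> Zm"]) (simp_all only: DF A2_def img_comp Un_assoc)
  qed
  have "D i - D (Suc i) \<subseteq> {(F i x, F i y), (F i y, F i x)}"
    using img_diff[of "T i" "T (Suc i)" x y "F i"] xy unfolding U by blast
  moreover have "D (Suc i) - D i \<subseteq> {(F i u, F i v), (F i v, F i u)}"
    using img_diff[of "T (Suc i)" "T i" u v "F i"] uv unfolding U by blast
  moreover have "tri X (D i)" "tri X (D (Suc i))"
    using tri_D assms(1) by auto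
  ultimately show ?thesis
    using tri_eq_or_flip[of X "D i" "D (Suc i)" "F i x" "F i y" "F i u" "F i v"]
    unfolding flips_def by blast
qed

end

text \<open>Four points, three classes: two of the points share a class, and then \<open>F\<close> or \<open>G\<close>
  identifies them.\<close>

lemma pigeonhole_sep:
  assumes "sep (F x) (F y) (F u) (F v)" "sep (G x) (G y) (G u) (G v)"
    and cover: "\<And>z. z \<in> P \<or> z \<in> Q \<or> z \<in> R"
    and P: "\<And>z. z \<in> P \<Longrightarrow> F z = p" and Q: "\<And>z. z \<in> Q \<Longrightarrow> G z = q"
    and R: "(\<forall>z\<in>R. F z = r) \<or> (\<forall>z\<in>R. G z = r)"
  shows False
proof -
  have d: "distinct [F x, F y, F u, F v]" "distinct [G x, G y, G u, G v]"
    using assms(1,2) sep_distinct by blast+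
  then have "distinct [x, y, u, v]"
    by auto
  then have "card {x, y, u, v} = 4"
    using distinct_card[of "[x, y, u, v]"] by simp
  define h where "h z = (if z \<in> P then 0 else if z \<in> Q then 1 else 2 :: nat)" for z
  have "h ` {x, y, u, v} \<subseteq> {0, 1, 2}"
    unfolding h_def by auto
  then have "card (h ` {x, y, u, v}) \<le> card {0, 1, 2 :: nat}"
    by (intro card_mono) auto
  then have "\<not> inj_on h {x, y, u, v}"
    using \<open>card {x, y, u, v} = 4\<close> card_image[of h "{x, y, u, v}"] by auto
  then obtain z w where zw: "z \<in> {x, y, u, v}" "w \<in> {x, y, u, v}" "z \<noteq> w" "h z = h w"
    unfolding inj_on_def by blast
  then have "z \<in> P \<and> w \<in> P \<or> z \<in> Q \<and> w \<in> Q \<or> z \<in> R \<and> w \<in> R"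
    using cover[of z] cover[of w] unfolding h_def by (auto split: if_splits)
  then have "F z = F w \<or> G z = G w"
    using P Q R by metis
  then show False
    using d zw by auto
qed

section \<open>Combining the path with its reversal\<close>

context tri_path
begin

text \<open>Time reversal exchanges the first and the last edge; the cyclic orientation is kept and
  the two cases of \<open>ml\<close> are swapped.\<close>

lemma reverse: "tri_path X (\<lambda>i. T (k - i)) k (k - m) pl ql rl pm qm rm a b c"
proof
  show "(pm, qm, rm, a, b, c) = (ql, rl, pl, rl, pl, ql) \<or> (pm, qm, rm, a, b, c) = (rl, pl, ql, ql, rl, pl)"
    using ml by auto
  show "pl \<in> X" "ql \<in> X" "rl \<in> X" "pl \<noteq> ql" "ql \<noteq> rl" "rl \<noteq> pl"
    using ml abc abcX by auto
qed (use fin mk ab0 pqm pql T in auto)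

lemma F_a: "v = a \<or> sep a b v c \<Longrightarrow> F i v = a"
  using corner_not_side[of a] unfolding F_def collapse_def by auto

lemma F_m: "m \<le> i \<Longrightarrow> v = pm \<or> sep pm qm v rm \<Longrightarrow> F i v = pm"
  using corner_not_side[of pm] sides_disjoint(1)[of v] pqr unfolding F_def collapse_def by auto

text \<open>Each class is an outer region together with the corner it is contracted to; by the
  cyclic orientation these are all three corners.\<close>

lemma cover: "(v = a \<or> sep a b v c) \<or> (v = pl \<or> sep pl ql v rl) \<or> (v = pm \<or> sep pm qm v rm)"
  using sides_cover[of v] ml by auto

end

locale tri_path_bidirectional = tri_path +
  rev: tri_path X "\<lambda>i. T (k - i)" k "k - m" pl ql rl pm qm rm a b c
begin

lemma rev_S: "rev.S = S"
  unfolding rev.S_def S_def rev.Z0_def rev.Zm_def rev.Zl_def Z0_def Zm_def Zl_def using mk by auto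

text \<open>Step \<open>i\<close> is step \<open>k - Suc i\<close> of the reversed path.
  \<open>F\<close> collapses the region beyond \<open>ab\<close>, \<open>rev.F\<close> the one
  beyond the last edge, and the middle region is collapsed by \<open>F\<close> if
  \<open>m \<le> i\<close> and by \<open>rev.F\<close> otherwise.\<close>

lemma no_double_flip:
  assumes "i < k" "sep (F i x) (F i y) (F i u) (F i v)"
  shows "\<not> sep (rev.F (k - Suc i) x) (rev.F (k - Suc i) y) (rev.F (k - Suc i) u) (rev.F (k - Suc i) v)"
proof
  let ?R = "{v. v = pm \<or> sep pm qm v rm}"
  assume G: "sep (rev.F (k - Suc i) x) (rev.F (k - Suc i) y) (rev.F (k - Suc i) u) (rev.F (k - Suc i) v)"
  have "(\<forall>z\<in>?R. F i z = pm) \<or> (\<forall>z\<in>?R. rev.F (k - Suc i) z = pm)"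
  proof (cases "m \<le> i")
    case True
    then show ?thesis
      using F_m by blast
  next
    case False
    then have "k - m \<le> k - Suc i"
      by simp
    then show ?thesis
      using rev.F_m by blast
  qed
  then show False
    using pigeonhole_sep[OF assms(2) G, of "{v. v = a \<or> sep a b v c}" "{v. v = pl \<or> sep pl ql v rl}" ?R a pl pm]
      cover F_a rev.F_a by blast
qed

text \<open>The first flip replaces \<open>ab\<close> by \<open>ps\<close>: the contraction \<open>F\<close> moves \<open>p\<close> to
  \<open>a\<close>, and the reversed one moves \<open>s\<close> to \<open>b\<close>.\<close>

lemma first_flip_lost:
  assumes "0 < k" and ab: "T 0 - T 1 = {(a, b), (b, a)}" and ps: "T 1 - T 0 = {(p, s), (s, p)}"
    and p: "sep a b p c" and s: "sep b c s a"
  shows "F 0 p = F 0 a" "rev.F (k - 1) s = rev.F (k - 1) b"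
proof -
  show "F 0 p = F 0 a"
    using F_a p by simp
  show "rev.F (k - 1) s = rev.F (k - 1) b"
  proof (cases "(pl, ql, rl) = (b, c, a)")
    case True
    then show ?thesis
      using rev.F_a[of s] rev.F_a[of b] s by simp
  next
    case False
    then have pm: "(pm, qm, rm) = (b, c, a)"
      using ml by auto
    \<comment> \<open>If \<open>bc\<close> were already in \<open>T 0\<close>, it would survive the
      first flip and cross the new arc \<open>ps\<close> in \<open>T 1\<close>.\<close>
    have "m \<noteq> 0"
    proof
      assume "m = 0"
      then have "(b, c) \<in> T 0"
        using pqm pm by simp
      moreover have "(b, c) \<notin> T 0 - T 1"
        unfolding ab using abc by simp
      ultimately have "(b, c) \<in> T 1"
        by blast
      moreover have "(p, s) \<in> T 1"
        using ps by blast
      moreover have "tri X (T 1)"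
        using T[of 1] \<open>0 < k\<close> by simp
      ultimately have "\<not> sep b c p s"
        using tri_noncrossing by blast
      moreover have "p \<noteq> b" "p \<noteq> c" "\<not> sep b c p a"
        using p sep_distinct[OF p] sep_sides_disjoint(1)[OF p abc] by auto
      ultimately show False
        using s unfolding sep_def by auto
    qed
    then have "k - m \<le> k - 1"
      by simp
    then show ?thesis
      using rev.F_m[of "k - 1" s] rev.F_m[of "k - 1" b] pm s by simp
  qed
qed

text \<open>\<open>M\<close> and \<open>N\<close> collect the steps that survive in the two halves
  of the detour. They are disjoint and both miss 0, so together they have fewer than
  \<open>k\<close> elements.\<close>

lemma shortcut:
  assumes k: "0 < k" and ab: "T 0 - T 1 = {(a, b), (b, a)}" and ps: "T 1 - T 0 = {(p, s), (s, p)}"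
    and p: "sep a b p c" and s: "sep b c s a"
    and steps: "\<And>i. i < k \<Longrightarrow> (T i, T (Suc i)) \<in> flips X"
  shows "\<exists>n<k. (T 0, T k) \<in> flips X ^^ n"
proof -
  \<comment> \<open>The reversed construction ends at \<open>S\<close>; read backwards it leads from
    \<open>S\<close> to \<open>T k\<close>.\<close>
  define E where "E i = rev.D (k - i)" for i
  define M where "M = {i. i < k \<and> D i \<noteq> D (Suc i)}"
  define N where "N = {i. i < k \<and> E i \<noteq> E (Suc i)}"
  have E: "E i = E (Suc i) \<or> (E i, E (Suc i)) \<in> flips X \<and>
      sep (rev.F (k - Suc i) x) (rev.F (k - Suc i) y) (rev.F (k - Suc i) u) (rev.F (k - Suc i) v)"
    if "i < k" "T i - T (Suc i) = {(x, y), (y, x)}" "T (Suc i) - T i = {(u, v), (v, u)}" for i x y u v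
  proof -
    have "k - (k - Suc i) = Suc i" "k - Suc (k - Suc i) = i" "Suc (k - Suc i) = k - i"
      using \<open>i < k\<close> by auto
    \<comment> \<open>Backwards in time \<open>uv\<close> is exchanged for \<open>xy\<close>, hence
      the swapped arguments.\<close>
    then show ?thesis
      using rev.D_step[of "k - Suc i" u v x y] that unfolding E_def
      by (metis flips_sym sep_swap diff_less zero_less_Suc k)
  qed
  have step: "\<exists>x y u v. T i - T (Suc i) = {(x, y), (y, x)} \<and> T (Suc i) - T i = {(u, v), (v, u)}" if "i < k" for i
    using steps[OF that] unfolding flips_def by auto
  have "(D 0, D k) \<in> flips X ^^ card M"
    unfolding M_def using D_step step by (intro relpow_stuttering) metis
  moreover have "(E 0, E k) \<in> flips X ^^ card N"
    unfolding N_def using E step by (intro relpow_stuttering) metis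
  moreover have "D 0 = T 0" "D k = S" "E 0 = S" "E k = T k"
    using D_0 D_k rev.D_0 rev.D_k rev_S unfolding E_def by auto
  ultimately have path: "(T 0, T k) \<in> flips X ^^ (card M + card N)"
    by (auto simp: relpow_add)
  have "i \<notin> N" if i: "i \<in> M" for i
  proof -
    have "i < k" "D i \<noteq> D (Suc i)"
      using i unfolding M_def by auto
    then obtain x y u v where xy: "T i - T (Suc i) = {(x, y), (y, x)}" "T (Suc i) - T i = {(u, v), (v, u)}"
      using step[OF \<open>i < k\<close>] by (elim exE conjE) (rule that)
    have "sep (F i x) (F i y) (F i u) (F i v)"
      using D_step[OF \<open>i < k\<close> xy] \<open>D i \<noteq> D (Suc i)\<close> by blast
    then have "E i = E (Suc i)"
      using E[OF \<open>i < k\<close> xy] no_double_flip[OF \<open>i < k\<close>] by blast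
    then show ?thesis
      unfolding N_def by simp
  qed
  then have "M \<inter> N = {}"
    by blast
  moreover have "0 \<notin> M"
  proof -
    have "\<not> sep (F 0 a) (F 0 b) (F 0 p) (F 0 s)"
      using first_flip_lost(1)[OF k ab ps p s] sep_distinct by fastforce
    then show ?thesis
      using D_step[of 0 a b p s] k ab ps unfolding M_def by auto
  qed
  moreover have "0 \<notin> N"
  proof -
    have "\<not> sep (rev.F (k - 1) a) (rev.F (k - 1) b) (rev.F (k - 1) p) (rev.F (k - 1) s)"
      using first_flip_lost(2)[OF k ab ps p s] sep_distinct by fastforce
    then show ?thesis
      using E[of 0 a b p s] k ab ps unfolding N_def by auto
  qed
  moreover have "M \<subseteq> {..<k}" "N \<subseteq> {..<k}"
    unfolding M_def N_def by auto
  ultimately have "M \<union> N \<subset> {..<k}" and fin: "finite M" "finite N"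
    using k by (auto simp: finite_subset)
  then have "card (M \<union> N) < k"
    using psubset_card_mono[of "{..<k}" "M \<union> N"] by simp
  then have "card M + card N < k"
    using card_Un_disjoint[OF fin \<open>M \<inter> N = {}\<close>] by simp
  then show ?thesis
    using path by blast
qed

end

section \<open>Shortening a path that misses the triangle\<close>

text \<open>With o the crossing of \<open>ab\<close> and \<open>ps\<close>, a chord entering the
  triangle a o s through \<open>as\<close> leaves through \<open>ab\<close> or
  \<open>ps\<close>.\<close>

lemma sep_quadrilateral:
  "sep a b p s \<Longrightarrow> sep a s u v \<Longrightarrow> sep p s u v \<or> sep a b u v"
  unfolding sep_def btw_def by (smt (z3))

text \<open>An arc of \<open>A\<close> crossing \<open>as\<close> is not \<open>ab\<close>, so it is
  also in \<open>B\<close>; it would cross \<open>ab\<close> inside \<open>A\<close> or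
  \<open>ps\<close> inside \<open>B\<close>.\<close>

lemma flip_quadrilateral:
  assumes A: "tri X A" and B: "tri X B"
    and ab: "A - B = {(a, b), (b, a)}" and ps: "B - A = {(p, s), (s, p)}" and s: "sep a b p s"
  shows "(a, s) \<in> A"
proof (rule tri_maximal[OF A])
  have abA: "(a, b) \<in> A" and psB: "(p, s) \<in> B"
    using ab ps by auto
  show "a \<in> X" "s \<in> X" "a \<noteq> s"
    using tri_in[OF A abA] tri_in[OF B psB] sep_distinct[OF s] by auto
  show "\<not> sep a s u v" if uv: "(u, v) \<in> A" for u v
  proof
    assume as: "sep a s u v"
    then have "(u, v) \<notin> {(a, b), (b, a)}"
      using sep_distinct[OF as] by auto
    then have "(u, v) \<notin> A - B"
      unfolding ab .
    then have "(u, v) \<in> B"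
      using uv by blast
    then show False
      using sep_quadrilateral[OF s as] tri_noncrossing[OF A abA uv] tri_noncrossing[OF B psB] by blast
  qed
qed

text \<open>Let the first flip replace \<open>ab\<close> by \<open>ps\<close>, with \<open>p\<close>
  across \<open>ab\<close> from \<open>c\<close>. The triangle \<open>abs\<close> lies in
  \<open>T 0\<close> while \<open>abc\<close> does not, so \<open>s\<close> differs from
  \<open>c\<close> and lies beyond \<open>bc\<close> or \<open>ca\<close>.\<close>

lemma window_shortcut:
  fixes T :: "nat \<Rightarrow> (int \<times> int) set"
  assumes fin: "finite X" and abcX: "a \<in> X" "b \<in> X" "c \<in> X" and abc: "a \<noteq> b" "b \<noteq> c" "c \<noteq> a"
    and T: "\<And>i. i \<le> k \<Longrightarrow> tri X (T i)" and steps: "\<And>i. i < k \<Longrightarrow> (T i, T (Suc i)) \<in> flips X"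
    and k: "0 < k" and mk: "m \<le> k" and ab: "(a, b) \<in> T 0" "(a, b) \<notin> T 1"
    and others: "(b, c) \<in> T m \<and> (c, a) \<in> T k \<or> (c, a) \<in> T m \<and> (b, c) \<in> T k"
    and no: "\<not> ((b, c) \<in> T 0 \<and> (c, a) \<in> T 0)"
  shows "\<exists>n<k. (T 0, T k) \<in> flips X ^^ n"
proof -
  have T0: "tri X (T 0)" and T1: "tri X (T 1)"
    using T k by auto
  obtain x y u v where xy: "T 0 - T 1 = {(x, y), (y, x)}" and uv: "T 1 - T 0 = {(u, v), (v, u)}"
    using steps[OF k] unfolding flips_def by auto
  have "(a, b) \<in> {(x, y), (y, x)}"
    unfolding xy[symmetric] using ab by blast
  then have abd: "T 0 - T 1 = {(a, b), (b, a)}"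
    using xy by auto
  have "T 0 \<noteq> T 1"
    using ab by auto
  then have "sep a b u v"
    using tri_eq_or_flip[OF T0 T1, of a b u v] abd uv by simp
  then have "sep a b u c \<or> sep a b v c"
    using abc unfolding sep_def by auto
  then obtain p s where p: "sep a b p c" and ps: "T 1 - T 0 = {(p, s), (s, p)}" and sp: "sep a b p s"
    using uv \<open>sep a b u v\<close> sep_commute2 by (metis insert_commute)
  have "(a, s) \<in> T 0"
    using flip_quadrilateral[OF T0 T1 abd ps sp] .
  moreover have "(b, s) \<in> T 0"
    using flip_quadrilateral[OF T0 T1 _ ps, of b a] abd sp sep_commute1 by (simp add: insert_commute)
  ultimately have "s \<noteq> c"
    using no tri_in[OF T0] by blast
  moreover have "\<not> sep a b s c"
    using p sp unfolding sep_def by auto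
  ultimately have "sep b c s a \<or> sep c a s b"
    using sep_sides_cover[of a b c s] abc sep_distinct[OF sp] by auto
  then show ?thesis
  proof
    assume s: "sep b c s a"
    have "tri_path X T k m a b c b c a c a b \<or> tri_path X T k m a b c c a b b c a"
      using others assms(1-8) mk ab unfolding tri_path_def by auto
    then show ?thesis
      using tri_path_bidirectional.shortcut[OF tri_path_bidirectional.intro[OF _ tri_path.reverse] k abd ps p s steps]
      by blast
  next
    \<comment> \<open>Exchanging the names \<open>a\<close> and \<open>b\<close> turns this case
      into the previous one.\<close>
    assume "sep c a s b"
    then have s: "sep a c s b"
      using sep_commute1 by blast
    have rev: "(b, a) \<in> T 0" "\<And>x y i. i \<le> k \<Longrightarrow> (x, y) \<in> T i \<Longrightarrow> (y, x) \<in> T i"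
      using tri_in[OF T] ab by blast+
    have "tri_path X T k m b a c a c b c b a \<or> tri_path X T k m b a c c b a a c b"
      using others assms(1-8) mk rev unfolding tri_path_def by auto
    moreover have "T 0 - T 1 = {(b, a), (a, b)}" "sep b a p c"
      using abd p sep_commute1 by auto
    ultimately show ?thesis
      using tri_path_bidirectional.shortcut[OF tri_path_bidirectional.intro[OF _ tri_path.reverse] k _ ps _ s steps] by blast
  qed
qed

theorem shortcut_exists:
  fixes T :: "nat \<Rightarrow> (int \<times> int) set"
  assumes fin: "finite X" and abcX: "a \<in> X" "b \<in> X" "c \<in> X" and abc: "a \<noteq> b" "b \<noteq> c" "c \<noteq> a"
    and T: "\<And>i. i \<le> k \<Longrightarrow> tri X (T i)" and steps: "\<And>i. i < k \<Longrightarrow> (T i, T (Suc i)) \<in> flips X"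
    and edges: "\<And>e. e \<in> {(a, b), (b, c), (c, a)} \<Longrightarrow> \<exists>i\<le>k. e \<in> T i"
    and no: "\<And>i. i \<le> k \<Longrightarrow> \<not> {(a, b), (b, c), (c, a)} \<subseteq> T i"
  shows "\<exists>n<k. (T 0, T k) \<in> flips X ^^ n"
proof -
  let ?E = "{(a, b), (b, c), (c, a)}"
  define W where "W = (\<lambda>(lo, hi). lo \<le> hi \<and> hi \<le> k \<and> (\<forall>e\<in>?E. \<exists>i. lo \<le> i \<and> i \<le> hi \<and> e \<in> T i))"
  have "W (0, k)"
    unfolding W_def using edges by simp
  then obtain w where w: "W w" and min: "\<And>w'. W w' \<Longrightarrow> snd w - fst w \<le> snd w' - fst w'"
    using ex_has_least_nat[of W "(0, k)" "\<lambda>w. snd w - fst w"] by blast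
  obtain lo hi where [simp]: "w = (lo, hi)"
    by fastforce
  have E: "\<exists>i. lo \<le> i \<and> i \<le> hi \<and> e \<in> T i" if "e \<in> ?E" for e
    using w that unfolding W_def by auto
  have hi: "lo \<le> hi" "hi \<le> k"
    using w unfolding W_def by auto
  have "lo \<noteq> hi"
  proof
    assume "lo = hi"
    then have "?E \<subseteq> T hi"
      using E by (metis le_antisym subsetI)
    then show False
      using no hi by blast
  qed
  then have lohi: "lo < hi"
    using hi by simp
  \<comment> \<open>A shortest window cannot drop either end: within it some edge \<open>e0\<close>
    occurs only at \<open>lo\<close> and some \<open>e2\<close> only at \<open>hi\<close>.\<close>
  have "\<not> W (Suc lo, hi)" "\<not> W (lo, hi - 1)"
    using min[of "(Suc lo, hi)"] min[of "(lo, hi - 1)"] lohi by auto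
  moreover have "Suc lo \<le> hi" "lo \<le> hi - 1" "hi - 1 \<le> k"
    using lohi hi by auto
  ultimately obtain e0 e2 where e0: "e0 \<in> ?E" "\<And>i. Suc lo \<le> i \<Longrightarrow> i \<le> hi \<Longrightarrow> e0 \<notin> T i"
    and e2: "e2 \<in> ?E" "\<And>i. lo \<le> i \<Longrightarrow> i \<le> hi - 1 \<Longrightarrow> e2 \<notin> T i"
    using hi(2) unfolding W_def prod.case by meson
  have e0lo: "e0 \<in> T lo" "e0 \<notin> T (Suc lo)"
  proof -
    obtain i where "lo \<le> i" "i \<le> hi" "e0 \<in> T i"
      using E[OF e0(1)] by blast
    then show "e0 \<in> T lo"
      using e0(2)[of i] by (cases "i = lo") auto
    show "e0 \<notin> T (Suc lo)"
      using e0(2) lohi by simp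
  qed
  have "e2 \<in> T hi"
  proof -
    obtain i where "lo \<le> i" "i \<le> hi" "e2 \<in> T i"
      using E[OF e2(1)] by blast
    then show ?thesis
      using e2(2)[of i] by (cases "i = hi") auto
  qed
  have "e0 \<noteq> e2"
    using \<open>e2 \<in> T hi\<close> e0(2) lohi by auto
  \<comment> \<open>Rotating the names lets \<open>e0\<close> play the role of \<open>ab\<close>;
    either of the other two edges may come last.\<close>
  obtain x y z where xyz: "(x, y, z) \<in> {(a, b, c), (b, c, a), (c, a, b)}" "e0 = (x, y)"
    using e0(1) by blast
  have e2': "e2 = (y, z) \<or> e2 = (z, x)"
    using xyz e2(1) \<open>e0 \<noteq> e2\<close> by auto
  define e1 where "e1 = (if e2 = (y, z) then (z, x) else (y, z))"
  have "e1 \<in> ?E"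
    using xyz unfolding e1_def by auto
  then obtain m where m: "lo \<le> m" "m \<le> hi" "e1 \<in> T m"
    using E by blast
  have "\<exists>n<hi - lo. (T (lo + 0), T (lo + (hi - lo))) \<in> flips X ^^ n"
  proof (rule window_shortcut[where a = x and b = y and c = z and m = "m - lo"])
    show "(y, z) \<in> T (lo + (m - lo)) \<and> (z, x) \<in> T (lo + (hi - lo)) \<or>
        (z, x) \<in> T (lo + (m - lo)) \<and> (y, z) \<in> T (lo + (hi - lo))"
      using e2' e1_def m \<open>e2 \<in> T hi\<close> lohi by (auto split: if_splits)
    show "\<not> ((y, z) \<in> T (lo + 0) \<and> (z, x) \<in> T (lo + 0))"
      using no[of lo] e0lo(1) xyz lohi hi by auto
    show "(T (lo + i), T (lo + Suc i)) \<in> flips X" if "i < hi - lo" for i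
      using steps[of "lo + i"] that hi by simp
  qed (use xyz abcX abc fin T hi lohi m e0lo in auto)
  then obtain n where n: "n < hi - lo" "(T lo, T hi) \<in> flips X ^^ n"
    using lohi by auto
  have seg: "(T i, T j) \<in> flips X ^^ (j - i)" if "i \<le> j" "j \<le> k" for i j
    using that
  proof (induction j rule: dec_induct)
    case (step j)
    then show ?case
      using steps[of j] by (auto simp: Suc_diff_le)
  qed simp
  have "(T 0, T k) \<in> flips X ^^ (lo + n + (k - hi))"
  proof -
    have "(T 0, T lo) \<in> flips X ^^ lo" "(T hi, T k) \<in> flips X ^^ (k - hi)"
      using seg[of 0 lo] seg[of hi k] hi by auto
    then show ?thesis
      using n(2) unfolding relpow_add by blast
  qed
  then show ?thesis
    using n(1) hi by (intro exI[of _ "lo + n + (k - hi)"]) auto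
qed

section \<open>Points in convex position\<close>

text \<open>Twice the signed area of the triangle \<open>xyz\<close>, positive when
  counterclockwise.\<close>

definition orient :: "real^2 \<Rightarrow> real^2 \<Rightarrow> real^2 \<Rightarrow> real" where
  "orient x y z = (y$1 - x$1) * (z$2 - x$2) - (y$2 - x$2) * (z$1 - x$1)"

lemma orient_rotate: "orient y z x = orient x y z"
  unfolding orient_def by (simp add: algebra_simps)

lemma orient_swap: "orient x z y = - orient x y z"
  unfolding orient_def by (simp add: algebra_simps)

lemma orient_affine:
  "orient x y ((1 - t) *\<^sub>R u + t *\<^sub>R v) = (1 - t) * orient x y u + t * orient x y v"
  unfolding orient_def by (simp add: algebra_simps)

lemma orient_zero_imp_affine:
  assumes "orient x y z = 0" "x \<noteq> y"
  shows "\<exists>t. z = (1 - t) *\<^sub>R x + t *\<^sub>R y"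
proof -
  define n where "n = (y$1 - x$1)^2 + (y$2 - x$2)^2"
  have "n \<noteq> 0"
    using assms(2) unfolding n_def vec_eq_iff forall_2 by (auto simp: sum_power2_eq_zero_iff)
  \<comment> \<open>Coefficient of the orthogonal projection of \<open>z\<close> to the line through
    \<open>x\<close> and \<open>y\<close>.\<close>
  define t where "t = ((y$1 - x$1) * (z$1 - x$1) + (y$2 - x$2) * (z$2 - x$2)) / n"
  have t: "t * n = (y$1 - x$1) * (z$1 - x$1) + (y$2 - x$2) * (z$2 - x$2)"
    using \<open>n \<noteq> 0\<close> unfolding t_def by simp
  have "n * (z$1) = n * ((1 - t) * x$1 + t * y$1)" "n * (z$2) = n * ((1 - t) * x$2 + t * y$2)"
    using t assms(1) unfolding n_def orient_def by algebra+
  then have "z = (1 - t) *\<^sub>R x + t *\<^sub>R y"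
    using \<open>n \<noteq> 0\<close> unfolding vec_eq_iff forall_2 by simp
  then show ?thesis ..
qed

text \<open>Barycentric coordinates of \<open>a\<close> with respect to \<open>b\<close>,
  \<open>c\<close>, \<open>d\<close> as signed areas, cleared of denominators.\<close>

lemma orient_barycentric:
  "(orient a c d + orient a d b + orient a b c) *\<^sub>R a
    = orient a c d *\<^sub>R b + orient a d b *\<^sub>R c + orient a b c *\<^sub>R d"
  unfolding orient_def vec_eq_iff forall_2 by (simp add: algebra_simps)

text \<open>Divided by the common value in \<open>orient_diff\<close>, when nonzero, both sides are
  the intersection point of the lines \<open>uv\<close> and \<open>xy\<close>.\<close>

lemma segments_meet_identity:
  "orient x y u *\<^sub>R v - orient x y v *\<^sub>R u = orient u v y *\<^sub>R x - orient u v x *\<^sub>R y"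
  unfolding orient_def vec_eq_iff forall_2 by (simp add: algebra_simps)

lemma orient_diff: "orient x y u - orient x y v = orient u v y - orient u v x"
  unfolding orient_def by (simp add: algebra_simps)

locale convex_position =
  fixes X :: "(real^2) set"
  assumes finite_X: "finite X" and not_in_hull: "x \<in> X \<Longrightarrow> x \<notin> convex hull (X - {x})"
begin

lemma not_in_open_segment: "x \<in> X \<Longrightarrow> y \<in> X \<Longrightarrow> z \<in> X \<Longrightarrow> z \<noteq> x \<Longrightarrow> z \<noteq> y \<Longrightarrow> z \<notin> open_segment x y"
proof
  assume z: "x \<in> X" "y \<in> X" "z \<in> X" "z \<noteq> x" "z \<noteq> y" "z \<in> open_segment x y"
  have "z \<in> convex hull {x, y}"
    using z(6) open_closed_segment segment_convex_hull by blast
  moreover have "convex hull {x, y} \<subseteq> convex hull (X - {z})"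
    using z by (intro hull_mono) auto
  ultimately show False
    using not_in_hull z(3) by blast
qed

text \<open>Of three collinear points one lies between the other two; which one depends on the
  position of \<open>t\<close> relative to 0 and 1.\<close>

lemma orient_nonzero:
  assumes "x \<in> X" "y \<in> X" "z \<in> X" "x \<noteq> y" "y \<noteq> z" "z \<noteq> x"
  shows "orient x y z \<noteq> 0"
proof
  assume "orient x y z = 0"
  then obtain t where t: "z = (1 - t) *\<^sub>R x + t *\<^sub>R y"
    using orient_zero_imp_affine assms by blast
  have "t \<noteq> 0" "t \<noteq> 1"
    using t assms by auto
  then consider "0 < t" "t < 1" | "1 < t" | "t < 0"
    by linarith
  then show False
  proof cases
    case 1
    then have "z \<in> open_segment x y"
      using t assms(4) unfolding in_segment by auto
    then show False
      using not_in_open_segment assms by blast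
  next
    case 2
    have "y = (1 - 1 / t) *\<^sub>R x + (1 / t) *\<^sub>R z"
      using 2 unfolding t by (simp add: algebra_simps)
    then have "y \<in> open_segment x z"
      using 2 assms(6) unfolding in_segment by (intro conjI exI[of _ "1 / t"]) auto
    then show False
      using not_in_open_segment assms by blast
  next
    case 3
    define r where "r = 1 / (1 - t)"
    have r: "0 < r" "r < 1" "r * (1 - t) = 1"
      using 3 unfolding r_def by auto
    have rt: "r * t = r - 1"
      using r(3) by (simp add: algebra_simps)
    have "(1 - r) *\<^sub>R y + r *\<^sub>R z = (r * (1 - t)) *\<^sub>R x + (1 - r + r * t) *\<^sub>R y"
      unfolding t by (simp add: algebra_simps)
    then have "x = (1 - r) *\<^sub>R y + r *\<^sub>R z"
      unfolding r(3) unfolding rt by simp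
    then have "x \<in> open_segment y z"
      using r assms(5) unfolding in_segment by blast
    then show False
      using not_in_open_segment assms by blast
  qed
qed

text \<open>Otherwise all three barycentric coordinates of \<open>a\<close> in the triangle
  \<open>bcd\<close> are positive, contradicting convex position. This is transitivity of the
  angular order around \<open>a\<close>.\<close>

lemma orient_trans:
  assumes X: "a \<in> X" "b \<in> X" "c \<in> X" "d \<in> X" and "distinct [a, b, c, d]"
    and abc: "orient a b c > 0" and acd: "orient a c d > 0"
  shows "orient a b d > 0"
proof (rule ccontr)
  assume "\<not> orient a b d > 0"
  then have adb: "orient a d b > 0"
    using orient_nonzero[of a b d] X assms(5) orient_swap[of a b d] by auto
  define s where "s = orient a c d + orient a d b + orient a b c"
  have s: "s > 0"
    using abc acd adb unfolding s_def by simp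
  have "a = (1 / s) *\<^sub>R (s *\<^sub>R a)"
    using s by simp
  also have "\<dots> = (orient a c d / s) *\<^sub>R b + (orient a d b / s) *\<^sub>R c + (orient a b c / s) *\<^sub>R d"
    unfolding s_def orient_barycentric by (simp add: scaleR_add_right)
  finally have "a \<in> convex hull {b, c, d}"
    unfolding convex_hull_3 using abc acd adb s
    by (intro CollectI exI[of _ "orient a c d / s"] exI[of _ "orient a d b / s"] exI[of _ "orient a b c / s"])
      (auto simp: s_def simp flip: add_divide_distrib)
  moreover have "convex hull {b, c, d} \<subseteq> convex hull (X - {a})"
    using X assms(5) by (intro hull_mono) auto
  ultimately show False
    using not_in_hull X by blast
qed

text \<open>The counterclockwise numbering of \<open>X\<close> as seen from an arbitrary base vertex.\<close>

definition base :: "real^2" where "base = (SOME v. v \<in> X)"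

definition before :: "real^2 \<Rightarrow> real^2 \<Rightarrow> bool" where
  "before u v \<longleftrightarrow> u \<noteq> v \<and> (u = base \<or> v \<noteq> base \<and> orient base u v > 0)"

definition idx :: "real^2 \<Rightarrow> int" where
  "idx u = int (card {w \<in> X. before w u})"

lemma base_in: "x \<in> X \<Longrightarrow> base \<in> X"
  unfolding base_def by (rule someI)

lemma before_trans:
  assumes "u \<in> X" "v \<in> X" "w \<in> X" "before u v" "before v w"
  shows "before u w"
proof (cases "u = base \<or> v = base \<or> w = base \<or> u = w")
  case True
  then show ?thesis
    using assms orient_swap[of base u v] unfolding before_def by auto
next
  case False
  then show ?thesis
    using assms orient_trans[of base u v w] base_in unfolding before_def by auto
qed

lemma before_total: "u \<in> X \<Longrightarrow> v \<in> X \<Longrightarrow> u \<noteq> v \<Longrightarrow> before u v \<or> before v u"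
  using orient_nonzero[of base u v] orient_swap[of base u v] base_in unfolding before_def by auto

lemma idx_less:
  assumes "u \<in> X" "v \<in> X" "before u v"
  shows "idx u < idx v"
proof -
  have "{w \<in> X. before w u} \<subset> {w \<in> X. before w v}"
    using assms before_trans[of _ u v] unfolding before_def by blast
  then show ?thesis
    unfolding idx_def using finite_X by (simp add: psubset_card_mono)
qed

lemma idx_less_iff: "u \<in> X \<Longrightarrow> v \<in> X \<Longrightarrow> idx u < idx v \<longleftrightarrow> before u v"
  using idx_less before_total by (metis less_asym less_irrefl)

lemma inj_idx: "inj_on idx X"
  using idx_less before_total by (metis inj_onI less_irrefl)

lemma idx_eq_iff: "u \<in> X \<Longrightarrow> v \<in> X \<Longrightarrow> idx u = idx v \<longleftrightarrow> u = v"
  using inj_idx by (auto dest: inj_onD)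

text \<open>For \<open>x = base\<close> this is the definition of the order. Otherwise a clockwise
  triple \<open>xyz\<close> would, by transitivity around \<open>y\<close>, contradict the order of
  \<open>y\<close> and \<open>z\<close> as seen from \<open>base\<close>.\<close>

lemma orient_pos_of_idx:
  assumes X: "x \<in> X" "y \<in> X" "z \<in> X" and lt: "idx x < idx y" "idx y < idx z"
  shows "orient x y z > 0"
proof (cases "x = base")
  case True
  then show ?thesis
    using lt X unfolding idx_less_iff[OF X(1,2)] idx_less_iff[OF X(2,3)] before_def by auto
next
  case False
  have xz: "before x z" and xy: "before x y" and yz: "before y z"
    using lt X idx_less_iff[of x y] idx_less_iff[of y z] idx_less_iff[of x z] by auto
  then have ne: "y \<noteq> base" "z \<noteq> base" "x \<noteq> y" "y \<noteq> z" "x \<noteq> z"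
    using False unfolding before_def by auto
  have pos: "orient base x y > 0" "orient base y z > 0"
    using xy yz False ne unfolding before_def by auto
  show ?thesis
  proof (rule ccontr)
    assume "\<not> orient x y z > 0"
    then have "orient y x z > 0"
      using orient_nonzero[OF X] ne orient_swap[of y x z] orient_rotate[of y z x] by auto
    moreover have "orient y base x > 0"
      using pos(1) orient_rotate[of y base x] orient_rotate[of x y base] by simp
    ultimately have "orient y base z > 0"
      using orient_trans[of y base x z] X base_in ne False by auto
    then show False
      using pos(2) orient_swap[of y base z] orient_rotate[of y z base] by simp
  qed
qed

lemma orient_pos_iff_idx:
  assumes X: "x \<in> X" "y \<in> X" "z \<in> X" and d: "x \<noteq> y" "y \<noteq> z" "z \<noteq> x"
  shows "orient x y z > 0 \<longleftrightarrow> idx x < idx y \<and> idx y < idx z \<or> idx y < idx z \<and> idx z < idx x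
    \<or> idx z < idx x \<and> idx x < idx y"
proof -
  have *: "orient x y z > 0" if "x \<in> X" "y \<in> X" "z \<in> X"
    "idx x < idx y \<and> idx y < idx z \<or> idx y < idx z \<and> idx z < idx x
    \<or> idx z < idx x \<and> idx x < idx y" for x y z
    using that orient_pos_of_idx orient_rotate by metis
  have "idx x \<noteq> idx y" "idx y \<noteq> idx z" "idx z \<noteq> idx x"
    using X d idx_eq_iff by auto
  then show ?thesis
    using *[of x y z] *[of x z y] X orient_swap[of x y z] by linarith
qed

section \<open>Crossing segments and separated indices\<close>

lemma sep_idx_iff:
  assumes X: "x \<in> X" "y \<in> X" "u \<in> X" "v \<in> X" and d: "distinct [x, y, u, v]"
  shows "sep (idx x) (idx y) (idx u) (idx v) \<longleftrightarrow> (orient x y u > 0 \<longleftrightarrow> orient x y v < 0)"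
proof -
  have "orient x y v < 0 \<longleftrightarrow> \<not> orient x y v > 0"
    using orient_nonzero[OF X(1,2,4)] d by auto
  moreover have "idx x \<noteq> idx y" "idx x \<noteq> idx u" "idx x \<noteq> idx v" "idx y \<noteq> idx u" "idx y \<noteq> idx v"
    using X d idx_eq_iff by auto
  moreover have "orient x y u > 0 \<longleftrightarrow> idx x < idx y \<and> idx y < idx u \<or> idx y < idx u \<and> idx u < idx x
    \<or> idx u < idx x \<and> idx x < idx y"
    "orient x y v > 0 \<longleftrightarrow> idx x < idx y \<and> idx y < idx v \<or> idx y < idx v \<and> idx v < idx x
    \<or> idx v < idx x \<and> idx x < idx y"
    using orient_pos_iff_idx[OF X(1,2,3)] orient_pos_iff_idx[OF X(1,2,4)] d by auto
  ultimately show ?thesis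
    unfolding sep_def btw_def by (smt (z3))
qed

text \<open>At a common point \<open>orient x y\<close> vanishes, and it is affine along
  \<open>uv\<close>. So its values at \<open>u\<close> and \<open>v\<close> have opposite signs,
  unless both vanish, which would force the two segments to coincide.\<close>

lemma open_segments_meet_opposite:
  assumes X: "x \<in> X" "y \<in> X" "u \<in> X" "v \<in> X" and "x \<noteq> y" "u \<noteq> v" "{x, y} \<noteq> {u, v}"
    and meet: "open_segment x y \<inter> open_segment u v \<noteq> {}"
  shows "distinct [x, y, u, v] \<and> (orient x y u > 0 \<longleftrightarrow> orient x y v < 0)"
proof -
  obtain s t where s: "0 < s" "s < 1" and t: "0 < t" "t < 1"
    and st: "(1 - s) *\<^sub>R x + s *\<^sub>R y = (1 - t) *\<^sub>R u + t *\<^sub>R v"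
    using meet unfolding in_segment disjoint_iff by auto
  have "orient x y ((1 - s) *\<^sub>R x + s *\<^sub>R y) = 0"
    unfolding orient_affine by (simp add: orient_def)
  then have sum: "(1 - t) * orient x y u + t * orient x y v = 0"
    unfolding st orient_affine .
  have on: "orient x y w = 0 \<longleftrightarrow> w = x \<or> w = y" if "w \<in> X" for w
    using orient_nonzero[of x y w] that X \<open>x \<noteq> y\<close> by (auto simp: orient_def)
  have "orient x y u = 0 \<longleftrightarrow> orient x y v = 0"
    using sum t by auto
  then have "u \<noteq> x" "u \<noteq> y" "v \<noteq> x" "v \<noteq> y" and nz: "orient x y u \<noteq> 0" "orient x y v \<noteq> 0"
    using on X \<open>u \<noteq> v\<close> \<open>{x, y} \<noteq> {u, v}\<close> by (auto simp: doubleton_eq_iff)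
  have "orient x y u > 0 \<longleftrightarrow> (1 - t) * orient x y u > 0" "orient x y v < 0 \<longleftrightarrow> t * orient x y v < 0"
    using t by (auto simp: zero_less_mult_iff mult_less_0_iff)
  then have "orient x y u > 0 \<longleftrightarrow> orient x y v < 0"
    using sum by linarith
  then show ?thesis
    using \<open>u \<noteq> x\<close> \<open>u \<noteq> y\<close> \<open>v \<noteq> x\<close> \<open>v \<noteq> y\<close> \<open>x \<noteq> y\<close> \<open>u \<noteq> v\<close> by auto
qed

lemma opposite_open_segments_meet:
  assumes X: "x \<in> X" "y \<in> X" "u \<in> X" "v \<in> X" and d: "distinct [x, y, u, v]"
    and o1: "orient x y u > 0 \<longleftrightarrow> orient x y v < 0" and o2: "orient u v x > 0 \<longleftrightarrow> orient u v y < 0"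
  shows "open_segment x y \<inter> open_segment u v \<noteq> {}"
proof -
  let ?\<alpha> = "orient x y u" and ?\<beta> = "orient x y v" and ?\<gamma> = "orient u v x" and ?\<delta> = "orient u v y"
  have nz: "?\<alpha> \<noteq> 0" "?\<beta> \<noteq> 0" "?\<gamma> \<noteq> 0" "?\<delta> \<noteq> 0"
    using orient_nonzero X d by auto
  define D where "D = ?\<alpha> - ?\<beta>"
  have D: "D = ?\<delta> - ?\<gamma>"
    unfolding D_def by (rule orient_diff)
  \<comment> \<open>The parameters of the intersection of the two lines, read off from
    \<open>segments_meet_identity\<close>; the sign conditions place both strictly between 0 and
    1.\<close>
  define t where "t = ?\<alpha> / D"
  define s where "s = - ?\<gamma> / D"
  have "D \<noteq> 0"
    using nz o1 unfolding D_def by auto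
  have t: "0 < t" "t < 1" "1 - t = - ?\<beta> / D"
    using nz o1 \<open>D \<noteq> 0\<close> unfolding t_def D_def by (auto simp: field_simps zero_less_divide_iff)
  have s: "0 < s" "s < 1" "1 - s = ?\<delta> / D"
    using nz o2 \<open>D \<noteq> 0\<close> unfolding s_def D by (auto simp: field_simps zero_less_divide_iff)
  have "(1 - t) *\<^sub>R u + t *\<^sub>R v = (1 / D) *\<^sub>R (?\<alpha> *\<^sub>R v - ?\<beta> *\<^sub>R u)"
    unfolding t(3) unfolding t_def by (simp add: scaleR_diff_right)
  also have "\<dots> = (1 / D) *\<^sub>R (?\<delta> *\<^sub>R x - ?\<gamma> *\<^sub>R y)"
    unfolding segments_meet_identity ..
  also have "\<dots> = (1 - s) *\<^sub>R x + s *\<^sub>R y"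
    unfolding s(3) unfolding s_def by (simp add: scaleR_diff_right)
  finally have "(1 - t) *\<^sub>R u + t *\<^sub>R v = (1 - s) *\<^sub>R x + s *\<^sub>R y" .
  then have "(1 - t) *\<^sub>R u + t *\<^sub>R v \<in> open_segment x y" "(1 - t) *\<^sub>R u + t *\<^sub>R v \<in> open_segment u v"
    using s t d unfolding in_segment by auto
  then show ?thesis
    by blast
qed

lemma crossing_iff_sep:
  assumes X: "x \<in> X" "y \<in> X" "u \<in> X" "v \<in> X" and "x \<noteq> y" "u \<noteq> v"
  shows "crossing (closed_segment x y) (closed_segment u v) \<longleftrightarrow> sep (idx x) (idx y) (idx u) (idx v)"
proof
  assume "crossing (closed_segment x y) (closed_segment u v)"
  then have "{x, y} \<noteq> {u, v}" "open_segment x y \<inter> open_segment u v \<noteq> {}"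
    using assms(5,6) unfolding crossing_def
    by (auto simp: rel_interior_closed_segment doubleton_eq_iff closed_segment_commute)
  then show "sep (idx x) (idx y) (idx u) (idx v)"
    using open_segments_meet_opposite[OF assms] sep_idx_iff[OF X] by blast
next
  assume s: "sep (idx x) (idx y) (idx u) (idx v)"
  then have d: "distinct [x, y, u, v]" "distinct [u, v, x, y]"
    using sep_distinct[OF s] X assms(5,6) by auto
  have s': "sep (idx u) (idx v) (idx x) (idx y)"
    using s sep_swap by blast
  have "open_segment x y \<inter> open_segment u v \<noteq> {}"
    using opposite_open_segments_meet[OF X d(1)] s s' sep_idx_iff[OF X d(1)]
      sep_idx_iff[OF X(3,4,1,2) d(2)] by blast
  moreover have "closed_segment x y \<noteq> closed_segment u v"
    using d by (auto simp: closed_segment_eq)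
  ultimately show "crossing (closed_segment x y) (closed_segment u v)"
    using assms(5,6) unfolding crossing_def by (simp add: rel_interior_closed_segment)
qed

end

section \<open>Transfer to the flip-graph\<close>

context convex_position
begin

definition pairs :: "(real^2) set set \<Rightarrow> (int \<times> int) set" where
  "pairs T = {(idx x, idx y) | x y. x \<in> X \<and> y \<in> X \<and> x \<noteq> y \<and> closed_segment x y \<in> T}"

definition arcs_of :: "(int \<times> int) set \<Rightarrow> (real^2) set set" where
  "arcs_of S = {closed_segment x y | x y. x \<in> X \<and> y \<in> X \<and> (idx x, idx y) \<in> S}"

lemma pairs_iff: "x \<in> X \<Longrightarrow> y \<in> X \<Longrightarrow> (idx x, idx y) \<in> pairs T \<longleftrightarrow> x \<noteq> y \<and> closed_segment x y \<in> T"
  unfolding pairs_def using idx_eq_iff by auto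

lemma arcs_of_iff:
  "sym S \<Longrightarrow> x \<in> X \<Longrightarrow> y \<in> X \<Longrightarrow> closed_segment x y \<in> arcs_of S \<longleftrightarrow> (idx x, idx y) \<in> S"
  unfolding arcs_of_def by (auto simp: closed_segment_eq doubleton_eq_iff dest: symD)

lemma arcs_of_pairs:
  assumes "T \<subseteq> segs X"
  shows "arcs_of (pairs T) = T"
proof (intro equalityI subsetI)
  fix s assume "s \<in> arcs_of (pairs T)"
  then show "s \<in> T"
    unfolding arcs_of_def using pairs_iff by auto
next
  fix s assume "s \<in> T"
  moreover from this obtain x y where "s = closed_segment x y" "x \<in> X" "y \<in> X" "x \<noteq> y"
    using assms unfolding segs_def by blast
  ultimately show "s \<in> arcs_of (pairs T)"
    unfolding arcs_of_def using pairs_iff by blast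
qed

lemma crossing_commute: "crossing s t \<longleftrightarrow> crossing t s"
  unfolding crossing_def by auto

lemma triangulation_segs: "triangulation X T \<Longrightarrow> T \<subseteq> segs X"
  unfolding triangulation_def noncrossing_def by blast

lemma triangulation_maximal:
  assumes T: "triangulation X T" and s: "s \<in> segs X" and "\<And>t. t \<in> T \<Longrightarrow> \<not> crossing s t"
  shows "s \<in> T"
proof -
  have "noncrossing X (insert s T)"
    using T s assms(3) crossing_commute unfolding triangulation_def noncrossing_def crossing_def by blast
  then show ?thesis
    using T unfolding triangulation_def by blast
qed

lemma tri_pairs:
  assumes T: "triangulation X T"
  shows "tri (idx ` X) (pairs T)"
proof (rule triI)
  show "i \<in> idx ` X \<and> j \<in> idx ` X \<and> i \<noteq> j \<and> (j, i) \<in> pairs T" if "(i, j) \<in> pairs T" for i j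
  proof -
    obtain x y where xy: "i = idx x" "j = idx y" "x \<in> X" "y \<in> X" "x \<noteq> y" "closed_segment x y \<in> T"
      using \<open>(i, j) \<in> pairs T\<close> unfolding pairs_def by blast
    then have "closed_segment y x \<in> T"
      by (simp add: closed_segment_commute)
    then show ?thesis
      using xy pairs_iff[of y x] idx_eq_iff[of x y] by auto
  qed
  show "\<not> sep i j l m" if ij: "(i, j) \<in> pairs T" and lm: "(l, m) \<in> pairs T" for i j l m
  proof -
    obtain x y where xy: "i = idx x" "j = idx y" "x \<in> X" "y \<in> X" "x \<noteq> y" "closed_segment x y \<in> T"
      using ij unfolding pairs_def by blast
    obtain u v where uv: "l = idx u" "m = idx v" "u \<in> X" "v \<in> X" "u \<noteq> v" "closed_segment u v \<in> T"
      using lm unfolding pairs_def by blast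
    have "\<not> crossing (closed_segment x y) (closed_segment u v)"
      using T xy(6) uv(6) unfolding triangulation_def noncrossing_def by blast
    then show ?thesis
      using crossing_iff_sep[of x y u v] xy uv by blast
  qed
  show "(i, j) \<in> pairs T" if ij: "i \<in> idx ` X" "j \<in> idx ` X" "i \<noteq> j"
    and uncrossed: "\<And>l m. (l, m) \<in> pairs T \<Longrightarrow> \<not> sep i j l m" for i j
  proof -
    obtain x y where xy: "i = idx x" "j = idx y" "x \<in> X" "y \<in> X" "x \<noteq> y"
      using ij by blast
    have "closed_segment x y \<in> T"
    proof (rule triangulation_maximal[OF T])
      show "closed_segment x y \<in> segs X"
        using xy unfolding segs_def by blast
      show "\<not> crossing (closed_segment x y) t" if t: "t \<in> T" for t
      proof -
        obtain u v where "t = closed_segment u v" "u \<in> X" "v \<in> X" "u \<noteq> v"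
          using t triangulation_segs[OF T] unfolding segs_def by blast
        then show ?thesis
          using crossing_iff_sep[of x y u v] xy uncrossed[of "idx u" "idx v"] pairs_iff[of u v] t by auto
      qed
    qed
    then show ?thesis
      using xy pairs_iff by blast
  qed
qed

lemma triangulation_arcs_of:
  assumes S: "tri (idx ` X) S"
  shows "triangulation X (arcs_of S)"
proof -
  have sym: "sym S"
    using S by (rule tri_sym)
  have "noncrossing X (arcs_of S)"
    unfolding noncrossing_def
  proof (intro conjI ballI)
    show "arcs_of S \<subseteq> segs X"
      using tri_in[OF S] unfolding arcs_of_def segs_def by blast
    show "\<not> crossing s t" if "s \<in> arcs_of S" "t \<in> arcs_of S" for s t
    proof -
      obtain x y u v where "s = closed_segment x y" "t = closed_segment u v" "x \<in> X" "y \<in> X" "u \<in> X" "v \<in> X"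
        and S': "(idx x, idx y) \<in> S" "(idx u, idx v) \<in> S"
        using \<open>s \<in> arcs_of S\<close> \<open>t \<in> arcs_of S\<close> unfolding arcs_of_def by blast
      then show ?thesis
        using crossing_iff_sep[of x y u v] tri_in[OF S S'(1)] tri_in[OF S S'(2)] tri_noncrossing[OF S S'] by auto
    qed
  qed
  moreover have "U = arcs_of S" if U: "noncrossing X U" "arcs_of S \<subseteq> U" for U
  proof (rule equalityI[OF subsetI U(2)])
    fix s assume s: "s \<in> U"
    then obtain x y where xy: "s = closed_segment x y" "x \<in> X" "y \<in> X" "x \<noteq> y"
      using U(1) unfolding noncrossing_def segs_def by blast
    have "(idx x, idx y) \<in> S"
    proof (rule tri_maximal[OF S])
      show "\<not> sep (idx x) (idx y) l m" if lm: "(l, m) \<in> S" for l m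
      proof -
        obtain u v where uv: "l = idx u" "m = idx v" "u \<in> X" "v \<in> X" "u \<noteq> v"
          using tri_in[OF S lm] by blast
        then have "closed_segment u v \<in> U"
          using lm U(2) arcs_of_iff[OF sym] by blast
        then have "\<not> crossing (closed_segment x y) (closed_segment u v)"
          using U(1) s xy(1) unfolding noncrossing_def by blast
        then show ?thesis
          using crossing_iff_sep[of x y u v] xy uv by blast
      qed
    qed (use xy idx_eq_iff in auto)
    then show "s \<in> arcs_of S"
      using xy unfolding arcs_of_def by blast
  qed
  ultimately show ?thesis
    unfolding triangulation_def by blast
qed

lemma pairs_diff:
  assumes "S \<subseteq> segs X" "card (S - T) = 1"
  shows "\<exists>i j. pairs S - pairs T = {(i, j), (j, i)}"
proof -
  obtain s where s: "S - T = {s}"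
    using assms(2) card_1_singletonE by blast
  then obtain x y where xy: "s = closed_segment x y" "x \<in> X" "y \<in> X" "x \<noteq> y"
    using assms(1) unfolding segs_def by blast
  have sub: "(i, j) \<in> {(idx x, idx y), (idx y, idx x)}" if ij: "(i, j) \<in> pairs S - pairs T" for i j
  proof -
    obtain u v where uv: "i = idx u" "j = idx v" "u \<in> X" "v \<in> X" "u \<noteq> v"
      using ij unfolding pairs_def by blast
    then have "closed_segment u v \<in> S - T"
      using ij pairs_iff by blast
    then have "closed_segment u v = closed_segment x y"
      unfolding s xy by blast
    then show ?thesis
      using uv by (auto simp: closed_segment_eq doubleton_eq_iff)
  qed
  have "closed_segment x y \<in> S - T" "closed_segment y x \<in> S - T"
    unfolding s xy by (auto simp: closed_segment_commute)
  then have "{(idx x, idx y), (idx y, idx x)} \<subseteq> pairs S - pairs T"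
    using xy pairs_iff by auto
  moreover have "pairs S - pairs T \<subseteq> {(idx x, idx y), (idx y, idx x)}"
    by (rule subrelI) (rule sub)
  ultimately have "pairs S - pairs T = {(idx x, idx y), (idx y, idx x)}"
    by (rule equalityI[rotated])
  then show ?thesis
    by blast
qed

lemma flips_pairs:
  assumes "triangulation X S" "triangulation X T" "flip S T"
  shows "(pairs S, pairs T) \<in> flips (idx ` X)"
proof -
  obtain i j l m where "pairs S - pairs T = {(i, j), (j, i)}" "pairs T - pairs S = {(l, m), (m, l)}"
    using assms(3) pairs_diff[OF triangulation_segs[OF assms(1)]]
      pairs_diff[OF triangulation_segs[OF assms(2)]] unfolding flip_def by metis
  then show ?thesis
    using tri_pairs assms(1,2) unfolding flips_def mem_Collect_eq prod.case by metis
qed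

lemma card_arcs_of_diff:
  assumes A: "tri (idx ` X) A" and B: "tri (idx ` X) B" and ij: "A - B = {(i, j), (j, i)}"
  shows "card (arcs_of A - arcs_of B) = 1"
proof -
  have sym: "sym A" "sym B"
    using A B by (auto intro: tri_sym)
  have "(i, j) \<in> A"
    using ij by blast
  then obtain x y where xy: "i = idx x" "j = idx y" "x \<in> X" "y \<in> X"
    using tri_in[OF A] by blast
  have sub: "s = closed_segment x y" if s: "s \<in> arcs_of A - arcs_of B" for s
  proof -
    obtain u v where uv: "s = closed_segment u v" "u \<in> X" "v \<in> X"
      using s unfolding arcs_of_def by blast
    then have "(idx u, idx v) \<in> A - B"
      using s arcs_of_iff[of _ u v] sym by blast
    then show ?thesis
      unfolding ij xy using uv xy idx_eq_iff by (auto simp: closed_segment_commute)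
  qed
  have "(idx x, idx y) \<in> A - B"
    unfolding ij xy by blast
  then have "closed_segment x y \<in> arcs_of A - arcs_of B"
    using arcs_of_iff[of _ x y] sym xy by blast
  then have "arcs_of A - arcs_of B = {closed_segment x y}"
    using sub by blast
  then show ?thesis
    by simp
qed

text \<open>Converts a combinatorial shortcut back into a walk, whose length can be compared with
  the graph distance.\<close>

lemma walk_of_flips:
  assumes "(A, B) \<in> flips (idx ` X) ^^ n" "tri (idx ` X) A"
  shows "\<exists>p. pre_digraph.awalk (flip_graph X) (arcs_of A) p (arcs_of B) \<and> length p = n"
  using assms
proof (induction n arbitrary: A)
  case 0
  interpret wf_digraph "flip_graph X"
    by (rule wf_digraph_flip_graph)
  have "arcs_of A \<in> verts (flip_graph X)"
    using triangulation_arcs_of[OF 0(2)] unfolding flip_graph_def by simp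
  then show ?case
    using 0(1) by (auto simp: awalk_Nil_iff)
next
  case (Suc n)
  interpret wf_digraph "flip_graph X"
    by (rule wf_digraph_flip_graph)
  obtain C where AC: "(A, C) \<in> flips (idx ` X)" and CB: "(C, B) \<in> flips (idx ` X) ^^ n"
    using relpow_Suc_D2[OF Suc.prems(1)] by blast
  have C: "tri (idx ` X) C"
    using AC unfolding flips_def by simp
  obtain p where p: "awalk (arcs_of C) p (arcs_of B)" "length p = n"
    using Suc.IH[OF CB C] by blast
  obtain i j l m where "A - C = {(i, j), (j, i)}" "C - A = {(l, m), (m, l)}"
    using AC unfolding flips_def mem_Collect_eq prod.case by (elim conjE exE) (rule that)
  then have "flip (arcs_of A) (arcs_of C)"
    using card_arcs_of_diff[OF Suc.prems(2) C] card_arcs_of_diff[OF C Suc.prems(2)]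
    unfolding flip_def by metis
  then have "(arcs_of A, arcs_of C) \<in> arcs (flip_graph X)"
    using triangulation_arcs_of[OF Suc.prems(2)] triangulation_arcs_of[OF C] by (simp add: flip_graph_def)
  moreover have "tail (flip_graph X) = fst" "head (flip_graph X) = snd"
    by (simp_all add: flip_graph_def)
  ultimately have "awalk (arcs_of A) ((arcs_of A, arcs_of C) # p) (arcs_of B)"
    using p(1) by (simp add: awalk_Cons_iff)
  then show ?case
    using p(2) by (intro exI[of _ "(arcs_of A, arcs_of C) # p"]) simp
qed

end

text \<open>Removing an extreme point leaves \<open>P\<close> convex, so the hull of the other
  vertices misses that point.\<close>

lemma convex_position_of_convex_polygon:
  assumes "convex_polygon P X"
  shows "convex_position X"
proof
  have P: "polytope P" and X: "X = {x. x extreme_point_of P}"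
    using assms unfolding convex_polygon_def by auto
  have convex: "convex P"
    using P by (rule polytope_imp_convex)
  show "finite X"
    unfolding X using P by (intro finite_polyhedron_extreme_points polytope_imp_polyhedron)
  show "x \<notin> convex hull (X - {x})" if "x \<in> X" for x
  proof -
    have "convex (P - {x})"
      using that convex extreme_point_of_stillconvex unfolding X by blast
    moreover have "X - {x} \<subseteq> P - {x}"
      unfolding X extreme_point_of_def by blast
    ultimately have "convex hull (X - {x}) \<subseteq> P - {x}"
      by (rule hull_minimal[rotated])
    then show ?thesis
      by blast
  qed
qed

lemma geodesic_flip_graphD:
  assumes "geodesic (flip_graph X) (map T [0..<Suc k])"
  shows "i \<le> k \<Longrightarrow> triangulation X (T i)" and "i < k \<Longrightarrow> flip (T i) (T (Suc i))"
    and "pre_digraph.awalk (flip_graph X) (T 0) p (T k) \<Longrightarrow> k \<le> length p"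
proof -
  interpret wf_digraph "flip_graph X"
    by (rule wf_digraph_flip_graph)
  let ?p = "map T [0..<Suc k]"
  have walk: "vwalk ?p (flip_graph X)" and dist: "ereal (real k) = \<mu> (\<lambda>_. 1) (T 0) (T k)"
    using assms unfolding geodesic_def vpath_def by (auto simp: hd_map last_map simp del: upt_Suc)
  show "triangulation X (T i)" if "i \<le> k" for i
  proof -
    have "T i \<in> set ?p"
      using that by (simp add: less_Suc_eq_le del: upt_Suc)
    then have "T i \<in> verts (flip_graph X)"
      using walk unfolding vwalk_def by blast
    then show ?thesis
      by (simp add: flip_graph_def)
  qed
  show "flip (T i) (T (Suc i))" if "i < k" for i
  proof -
    \<comment> \<open>Cutting the list just after \<open>T i\<close> exhibits the pair as the
      junction of two lists.\<close>
    have "?p = map T [0..<Suc i] @ map T [Suc i..<Suc k]"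
      using that upt_add_eq_append[of 0 "Suc i" "k - i"] by (simp del: upt_Suc flip: map_append)
    then have "(T i, T (Suc i)) \<in> set (vwalk_arcs ?p)"
      using that by (simp add: vwalk_arcs_append hd_map last_map del: upt_Suc)
    then have "(T i, T (Suc i)) \<in> arcs_ends (flip_graph X)"
      using walk unfolding vwalk_def by blast
    then show ?thesis
      unfolding arcs_ends_def arc_to_ends_def flip_graph_def by auto
  qed
  show "k \<le> length p" if "awalk (T 0) p (T k)" for p
  proof -
    \<comment> \<open>With unit weights the cost of a walk is its length.\<close>
    have "ereal (real k) \<le> ereal (real (length p))"
      using min_cost_le_walk_cost[OF that, of "\<lambda>_. 1"] unfolding dist awalk_cost_def
      by (simp add: sum_list_triv)
    then show ?thesis
      by simp
  qed
qed

theorem theorem1p1: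
  fixes P X :: "(real^2) set"
    and T :: "nat \<Rightarrow> (real^2) set set"
    and k :: nat
    and a b c :: "real^2"
  assumes "convex_polygon P X"
    and "geodesic (flip_graph X) (map T [0..<Suc k])"
    and "a \<in> X" and "b \<in> X" and "c \<in> X"
    and "a \<noteq> b" and "b \<noteq> c" and "c \<noteq> a"
    and "\<forall>e \<in> triangle_edges a b c. \<exists>i \<in> {0..k}. e \<in> T i"
  shows "\<exists>i \<in> {0..k}. \<forall>e \<in> triangle_edges a b c. e \<in> T i"
proof (rule ccontr)
  assume no: "\<not> ?thesis"
  interpret convex_position X
    using assms(1) by (rule convex_position_of_convex_polygon)
  note geodesic = geodesic_flip_graphD[OF assms(2)]
  have edge: "(idx x, idx y) \<in> pairs (T i) \<longleftrightarrow> closed_segment x y \<in> T i"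
    if "(x, y) \<in> {(a, b), (b, c), (c, a)}" for x y i
    using that assms(3-8) by (intro pairs_iff[THEN trans]) auto
  have "\<exists>n<k. (pairs (T 0), pairs (T k)) \<in> flips (idx ` X) ^^ n"
  proof (rule shortcut_exists[where a = "idx a" and b = "idx b" and c = "idx c"])
    show "tri (idx ` X) (pairs (T i))" if "i \<le> k" for i
      using geodesic(1)[OF that] by (rule tri_pairs)
    show "(pairs (T i), pairs (T (Suc i))) \<in> flips (idx ` X)" if "i < k" for i
      using geodesic(1)[of i] geodesic(1)[of "Suc i"] geodesic(2)[OF that] that by (intro flips_pairs) auto
    show "\<exists>i\<le>k. e \<in> pairs (T i)" if "e \<in> {(idx a, idx b), (idx b, idx c), (idx c, idx a)}" for e
      using assms(9) that edge unfolding triangle_edges_def by auto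
    show "\<not> {(idx a, idx b), (idx b, idx c), (idx c, idx a)} \<subseteq> pairs (T i)" if "i \<le> k" for i
      using no that edge unfolding triangle_edges_def by auto
  qed (use assms(3-8) finite_X idx_eq_iff in auto)
  then obtain n where n: "n < k" "(pairs (T 0), pairs (T k)) \<in> flips (idx ` X) ^^ n"
    by blast
  \<comment> \<open>Passing to pairs and back recovers each triangulation, so the shorter path of
    flips gives a walk between the two ends of the geodesic.\<close>
  have "arcs_of (pairs (T i)) = T i" if "i \<le> k" for i
    using arcs_of_pairs triangulation_segs geodesic(1) that by blast
  then obtain p where "pre_digraph.awalk (flip_graph X) (T 0) p (T k)" "length p = n"
    using walk_of_flips[OF n(2) tri_pairs[OF geodesic(1)[of 0]]] by auto
  then show False
    using geodesic(3) n(1) by fastforce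
qed

end
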